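(* Let $M_n$ be a random stack-triangulation with distribution $\mathbb{Q}^{\triangle}_{2n}$ and let $\Gamma_\triangle=2/11$. Let $k\in\mathbb{N}$ and let $\mathbf v_1,\dots,\mathbf v_k$ be $k$ nodes of $M_n$ chosen independently and uniformly among the internal nodes of $M_n$. Then, with $D_{M_n}$ the graph distance in $M_n$, $$\left(\frac{D_{M_n}(\mathbf v_i,\mathbf v_j)}{3\Gamma_\triangle\log n}\right)_{(i,j)\in\{1,\dots,k\}^2}\longrightarrow\left(\mathbf 1_{i\ne j}\right)_{(i,j)\in\{1,\dots,k\}^2}$$ in probability as $n\to\infty$.
   Context: Rooted planar maps: connected graphs properly embedded in the plane with a distinguished oriented edge $(E_0,E_1)$ having the infinite face on its right, up to homeomorphisms preserving orientation and root. Let $\Theta$ be the rooted triangle. For a rooted triangulation $m$ and a finite face $f$ of $m$, $\Phi(m,f)$ is obtained by adding a vertex $x$ inside $f$ and three non-crossing edges from $x$ to the vertices of $f$. The set of stack-triangulations with $2k$ faces is defined by $\triangle_2=\{\Theta\}$, $\triangle_{2(k+1)}=\{\Phi(m,f): m\in\triangle_{2k},\ f\text{ finite face of }m\}$. An internal node of a stack-triangulation is a vertex not adjacent to the infinite face (all vertices but three). $\mathbb{Q}^{\triangle}_{2n}$ is the law on $\triangle_{2n}$ of $M_n$, where $M_1=\Theta$ and $M_{k+1}=\Phi(M_k,F_k)$ with $F_k$ chosen uniformly among the finite faces of $M_k$, independently of the previous choices. *)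

theory Defs
  imports "HOL-Probability.Probability" "HOL-Complex_Analysis.Complex_Analysis"
begin

section \<open>Rooted maps drawn in the plane\<close>

text \<open>
  The plane is the type of complex numbers. An edge is the point set of its arc, end points
  included. The root is the oriented edge, given as the pair (origin, target); the maps
  considered here are simple graphs, so that this pair determines the edge.
\<close>

record emap =
  verts :: "complex set"
  edges :: "complex set set"
  root  :: "complex \<times> complex"

definition support :: "emap \<Rightarrow> complex set" where
  "support m = verts m \<union> \<Union>(edges m)"

definition faces :: "emap \<Rightarrow> complex set set" where
  "faces m = components (- support m)"

definition finite_faces :: "emap \<Rightarrow> complex set set" where
  "finite_faces m = {f \<in> faces m. bounded f}"

definition face_verts :: "emap \<Rightarrow> complex set \<Rightarrow> complex set" where
  "face_verts m f = verts m \<inter> frontier f"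

definition internal_verts :: "emap \<Rightarrow> complex set" where
  "internal_verts m = {v \<in> verts m. \<forall>f \<in> faces m. \<not> bounded f \<longrightarrow> v \<notin> face_verts m f}"

definition adj :: "emap \<Rightarrow> complex rel" where
  "adj m = {(u, v). u \<noteq> v \<and> (\<exists>e \<in> edges m. verts m \<inter> e = {u, v})}"

definition gdist :: "emap \<Rightarrow> complex \<Rightarrow> complex \<Rightarrow> nat" where
  "gdist m u v = (LEAST n. (u, v) \<in> adj m ^^ n)"


section \<open>Maps up to homeomorphism\<close>

text \<open>
  A homeomorphism of the plane preserves the orientation iff it sends every positively
  oriented circle to a closed curve that winds once, positively, around the image of
  the centre.
\<close>

definition orientation_preserving_homeo :: "(complex \<Rightarrow> complex) \<Rightarrow> bool" where
  "orientation_preserving_homeo h \<longleftrightarrow>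
     (\<exists>g. homeomorphism UNIV UNIV h g) \<and>
     (\<forall>z r. r > 0 \<longrightarrow> winding_number (h \<circ> circlepath z r) (h z) = 1)"

definition image_emap :: "(complex \<Rightarrow> complex) \<Rightarrow> emap \<Rightarrow> emap" where
  "image_emap h m = \<lparr>verts = h ` verts m, edges = (`) h ` edges m, root = map_prod h h (root m)\<rparr>"

type_synonym rooted_map = "emap set"

definition rooted_map_of :: "emap \<Rightarrow> rooted_map" where
  "rooted_map_of m = {image_emap h m | h. orientation_preserving_homeo h}"

text \<open>
  A rooted map is handled through one of its drawings. Taking a drawing with straight edges
  is harmless: every simple planar map has one, and faces, internal nodes and distances
  do not depend on the drawing up to homeomorphism.
\<close>

definition straight :: "emap \<Rightarrow> bool" where
  "straight m \<longleftrightarrow> (\<forall>e \<in> edges m. \<exists>u \<in> verts m. \<exists>v \<in> verts m. e = closed_segment u v)"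

definition drawing :: "rooted_map \<Rightarrow> emap" where
  "drawing M = (SOME m. m \<in> M \<and> straight m)"


section \<open>Stack-triangulations\<close>

text \<open>
  The third vertex lies on the left of the root edge from 0 to 1, hence the infinite face
  lies on its right.
\<close>

definition triangle :: emap where
  "triangle =
     \<lparr>verts = {0, 1, \<i>},
      edges = {closed_segment 0 1, closed_segment 1 \<i>, closed_segment \<i> 0},
      root = (0, 1)\<rparr>"

definition Theta :: rooted_map where
  "Theta = rooted_map_of triangle"

text \<open>
  The drawing \<open>m'\<close> is \<open>m\<close> together with a new vertex \<open>x\<close> in the face \<open>f\<close> and, for each vertex
  \<open>v\<close> of \<open>f\<close>, an arc \<open>\<gamma> v\<close> from \<open>x\<close> to \<open>v\<close> drawn inside \<open>f\<close>, these arcs meeting only in \<open>x\<close>.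
\<close>

definition insertion :: "emap \<Rightarrow> complex set \<Rightarrow> emap \<Rightarrow> bool" where
  "insertion m f m' \<longleftrightarrow>
     (\<exists>x \<in> f. \<exists>\<gamma> :: complex \<Rightarrow> real \<Rightarrow> complex.
        (\<forall>v \<in> face_verts m f. arc (\<gamma> v) \<and> pathstart (\<gamma> v) = x \<and> pathfinish (\<gamma> v) = v \<and>
           path_image (\<gamma> v) \<subseteq> insert v f) \<and>
        (\<forall>v \<in> face_verts m f. \<forall>w \<in> face_verts m f. v \<noteq> w \<longrightarrow>
           path_image (\<gamma> v) \<inter> path_image (\<gamma> w) = {x}) \<and>
        m' = \<lparr>verts = insert x (verts m),
              edges = edges m \<union> (\<lambda>v. path_image (\<gamma> v)) ` face_verts m f,
              root = root m\<rparr>)"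

text \<open>
  All drawings obtained by such an insertion are homeomorphic, so the union below is a
  single class.
\<close>

definition Phi :: "emap \<Rightarrow> complex set \<Rightarrow> rooted_map" where
  "Phi m f = (\<Union>m' \<in> {m'. insertion m f m'}. rooted_map_of m')"

text \<open>
  The law of \<open>M\<^sub>n\<close>, a stack-triangulation with \<open>2 * n\<close> faces. Only \<open>n \<ge> 1\<close> is meaningful;
  the value at 0 is a dummy.
\<close>

fun stack_law :: "nat \<Rightarrow> rooted_map pmf" where
  "stack_law 0 = return_pmf Theta"
| "stack_law (Suc 0) = return_pmf Theta"
| "stack_law (Suc (Suc k)) =
     bind_pmf (stack_law (Suc k)) (\<lambda>M.
       map_pmf (Phi (drawing M)) (pmf_of_set (finite_faces (drawing M))))"

text \<open>
  The joint law of (a drawing of) \<open>M\<^sub>n\<close> and of \<open>k\<close> nodes, which are, given \<open>M\<^sub>n\<close>, independent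
  and uniform among its internal nodes. There are \<open>n - 1\<close> internal nodes, so this is
  meaningful for \<open>n \<ge> 2\<close>.
\<close>

definition stack_nodes_law :: "nat \<Rightarrow> nat \<Rightarrow> (emap \<times> (nat \<Rightarrow> complex)) pmf" where
  "stack_nodes_law n k =
     bind_pmf (stack_law n) (\<lambda>M.
       map_pmf (Pair (drawing M))
         (Pi_pmf {1..k} undefined (\<lambda>_. pmf_of_set (internal_verts (drawing M)))))"

definition Gamma_tri :: real where
  "Gamma_tri = 2 / 11"

end

theory Submission
  imports Defs "HOL-Library.Sublist"
begin

text \<open>
  The history of a stack-triangulation is a ternary tree: an insertion into a face turns the leaf
  of that face into an internal node with three children. Leaves are the finite faces, internal
  nodes of the tree are the internal nodes of the map, and a uniform finite face is a uniform leaf.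
  Both are addressed by words over a three-letter alphabet, the letter saying which corner of the
  face was replaced by the new vertex.

  Fix a face and follow, along a branch of the tree that starts there, the distances of the three
  current corners to the corners of that face. A new vertex gets one plus the minimum of the three,
  so the three values differ by at most one, and the number of corners away from the minimum runs
  through 0, 1, 2, 0, ... with mean waiting times 1, 3/2 and 3. One unit of distance therefore costs
  11/2 generations, whence the constant 2/11. Two faces that part at a node of the tree have
  distance equal, up to 3, to the sum of their heights above that node (\<open>tree_dist_pair\<close>): going
  down to the corners of the separating face gives the upper bound, and the height counted
  positively in one branch and negatively in the other is a 1-Lipschitz function, which gives the
  lower bound.

  Concentration needs no second moment. For \<open>t > 2\<close> put \<open>z = t (t - 1) (t - 2) / 6\<close>. The three-state
  chain above has, when each unit of height is worth a factor \<open>z\<close>, the positive eigenvector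
  \<open>(1, t / 3, t (t - 1) / 6)\<close> with eigenvalue \<open>t\<close> (\<open>weight_dstep\<close>). The sum of the product weights of
  all pairs of faces, plus a suitable multiple of the number of faces, is therefore multiplied in
  mean by exactly \<open>1 + 2 (t - 1) / F\<close> when a map with \<open>F\<close> finite faces grows
  (\<open>sum_potential_grow\<close>). It follows that \<open>z\<close> to the power of the distance of two uniform nodes has
  mean \<open>O(n powr (t - 3))\<close>. As \<open>ln z\<close> vanishes at \<open>t = 3\<close> and has derivative 11/6 there, Markov's
  inequality with \<open>t\<close> slightly above 3 makes distances above \<open>(6/11) (1 + \<epsilon>) ln n\<close>, and with \<open>t\<close>
  slightly below 3 distances below \<open>(6/11) (1 - \<epsilon>) ln n\<close> unlikely. Here \<open>6/11 = 3 * (2/11)\<close>. The second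
  estimate also covers coinciding nodes, whose distance is 0.

  The remaining work is to see that maps drawn in the plane behave like their trees. A drawing
  realizes a tree if its vertices, adjacencies and finite faces are those of the tree and every
  finite face is the inside of a Jordan curve made of three edges. This is invariant under
  homeomorphisms and, by the theta-curve theorem, is inherited when a vertex is inserted
  (\<open>realizes_insertion\<close>). A new straight drawing is chosen for the class of each map; it exists since
  a face with straight edges is a triangle, in which a point can be joined to the corners by
  segments. Realization provides a coupling of the random maps with the random sets of leaves
  (\<open>stack_law_coupling\<close>).
\<close>


section \<open>Components of an open set\<close>

text \<open>
  Faces are components of the complement of a drawing. They are identified below by exhibiting the
  right disjoint open connected sets.
\<close>

lemma components_eq_open_partition:
  fixes U :: "'a::topological_space set"
  assumes "\<Union>\<C> = U" and disj: "pairwise disjnt \<C>"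
    and C: "\<And>C. C \<in> \<C> \<Longrightarrow> open C \<and> connected C \<and> C \<noteq> {}"
  shows "components U = \<C>"
proof -
  have sub: "C \<in> components U" if "C \<in> \<C>" for C
    unfolding in_components_maximal
  proof (intro conjI allI impI)
    show "C \<noteq> {}" "C \<subseteq> U" "connected C"
      using C[OF that] assms(1) that by auto
    fix D assume D: "D \<noteq> {} \<and> C \<subseteq> D \<and> D \<subseteq> U \<and> connected D"
    let ?R = "\<Union>(\<C> - {C})"
    have "open C" "open ?R" using C that by auto
    moreover have "C \<inter> ?R = {}"
      using disj that by (auto simp: pairwise_def disjnt_iff)
    moreover have "D \<subseteq> C \<union> ?R" using D assms(1) by auto
    moreover have "C \<inter> D \<noteq> {}" using D C[OF that] by auto
    ultimately have "?R \<inter> D = {}"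
      using connectedD[of D C ?R] D by blast
    then show "D = C" using D \<open>D \<subseteq> C \<union> ?R\<close> by blast
  qed
  have "K \<in> \<C>" if K: "K \<in> components U" for K
  proof -
    obtain x where "x \<in> K" using K in_components_nonempty by blast
    then have "x \<in> U" using K in_components_subset by blast
    then obtain C where "C \<in> \<C>" "x \<in> C" using assms(1) by blast
    then show ?thesis using components_eq[OF K sub] \<open>x \<in> K\<close> by blast
  qed
  with sub show ?thesis by blast
qed

section \<open>Arcs and triangular curves\<close>

text \<open>
  Arcs are handled as point sets, since edges of a map are point sets; orientation and
  parametrization are forgotten.
\<close>

definition arc_between :: "complex set \<Rightarrow> complex \<Rightarrow> complex \<Rightarrow> bool" where
  "arc_between S a b \<longleftrightarrow> (\<exists>g. arc g \<and> path_image g = S \<and> pathstart g = a \<and> pathfinish g = b)"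

lemma arc_between_sym: "arc_between S a b \<longleftrightarrow> arc_between S b a"
  unfolding arc_between_def
  by (metis arc_reversepath path_image_reversepath pathfinish_reversepath pathstart_reversepath)

lemma arc_between_ends: "arc_between S a b \<Longrightarrow> a \<in> S \<and> b \<in> S"
  unfolding arc_between_def by auto

lemma arc_between_neq: "arc_between S a b \<Longrightarrow> a \<noteq> b"
  unfolding arc_between_def using arc_distinct_ends by blast

lemma arc_between_closed: "arc_between S a b \<Longrightarrow> closed S"
  unfolding arc_between_def using closed_arc_image by blast

lemma arc_between_segment: "a \<noteq> b \<Longrightarrow> arc_between (closed_segment a b) a b"
  unfolding arc_between_def by (intro exI[of _ "linepath a b"]) auto

lemma arc_between_join:
  assumes "arc_between S a b" "arc_between T b c" "S \<inter> T = {b}"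
  shows "arc_between (S \<union> T) a c"
proof -
  obtain g h where "arc g" "path_image g = S" "pathstart g = a" "pathfinish g = b"
    "arc h" "path_image h = T" "pathstart h = b" "pathfinish h = c"
    using assms(1,2) unfolding arc_between_def by blast
  then show ?thesis
    using assms(3) unfolding arc_between_def
    by (intro exI[of _ "g +++ h"]) (simp add: arc_join path_image_join)
qed

definition jordan_curve :: "complex set \<Rightarrow> bool" where
  "jordan_curve C \<longleftrightarrow> (\<exists>c. simple_path c \<and> pathfinish c = pathstart c \<and> path_image c = C)"

lemma jordan_curve_facts:
  assumes "jordan_curve C"
  shows "inside C \<noteq> {}" "open (inside C)" "connected (inside C)" "outside C \<noteq> {}" "open (outside C)"
    "connected (outside C)" "bounded (inside C)" "\<not> bounded (outside C)"
    "inside C \<inter> outside C = {}" "inside C \<union> outside C = - C"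
    "frontier (inside C) = C" "frontier (outside C) = C"
  using assms Jordan_inside_outside unfolding jordan_curve_def by blast+

lemma jordan_curve_union_arcs:
  assumes "arc_between S a b" "arc_between T a b" "S \<inter> T = {a, b}"
  shows "jordan_curve (S \<union> T)"
proof -
  obtain g h where "arc g" "path_image g = S" "pathstart g = a" "pathfinish g = b"
    "arc h" "path_image h = T" "pathstart h = b" "pathfinish h = a"
    using assms(1,2) arc_between_sym unfolding arc_between_def by metis
  then show ?thesis
    using assms(3) unfolding jordan_curve_def
    by (intro exI[of _ "g +++ h"]) (simp add: simple_path_join_loop path_image_join)
qed

text \<open>
  The theta-curve theorem \<open>split_inside_simple_closed_curve\<close> for point sets.
\<close>

lemma split_inside_arcs:
  assumes "arc_between S a b" "arc_between T a b" "arc_between G a b"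
    and "S \<inter> T = {a, b}" "S \<inter> G = {a, b}" "T \<inter> G = {a, b}" "G \<inter> inside (S \<union> T) \<noteq> {}"
  shows "inside (S \<union> G) \<inter> inside (T \<union> G) = {}"
    and "inside (S \<union> G) \<union> inside (T \<union> G) \<union> (G - {a, b}) = inside (S \<union> T)"
proof -
  obtain s t g where "arc s" "path_image s = S" "pathstart s = a" "pathfinish s = b"
    "arc t" "path_image t = T" "pathstart t = a" "pathfinish t = b"
    "arc g" "path_image g = G" "pathstart g = a" "pathfinish g = b"
    using assms(1-3) unfolding arc_between_def by blast
  note * = this
  have "a \<noteq> b" using arc_between_neq assms(1) by blast
  have "inside (S \<union> G) \<inter> inside (T \<union> G) = {} \<and>
    inside (S \<union> G) \<union> inside (T \<union> G) \<union> (G - {a, b}) = inside (S \<union> T)"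
    by (rule split_inside_simple_closed_curve[of s a b t g])
       (use * assms(4-7) \<open>a \<noteq> b\<close> arc_imp_simple_path in auto)
  then show "inside (S \<union> G) \<inter> inside (T \<union> G) = {}"
    and "inside (S \<union> G) \<union> inside (T \<union> G) \<union> (G - {a, b}) = inside (S \<union> T)" by auto
qed

text \<open>
  The side \<open>S1\<close> is opposite to the corner \<open>a\<close>, and so on, so that replacing one corner keeps the
  opposite side.
\<close>

definition triangular :: "complex \<Rightarrow> complex \<Rightarrow> complex \<Rightarrow> complex set \<Rightarrow> complex set \<Rightarrow> complex set \<Rightarrow> bool" where
  "triangular a b c S1 S2 S3 \<longleftrightarrow> arc_between S1 b c \<and> arc_between S2 c a \<and> arc_between S3 a b \<and>
     S1 \<inter> S2 = {c} \<and> S2 \<inter> S3 = {a} \<and> S3 \<inter> S1 = {b}"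

lemma triangular_jordan:
  assumes "triangular a b c S1 S2 S3" shows "jordan_curve (S1 \<union> S2 \<union> S3)"
proof -
  have t: "arc_between S1 b c" "arc_between S2 c a" "arc_between S3 a b"
     "S1 \<inter> S2 = {c}" "S2 \<inter> S3 = {a}" "S3 \<inter> S1 = {b}"
    using assms by (auto simp: triangular_def)
  have "arc_between (S1 \<union> S2) b a" using arc_between_join t by blast
  moreover have "arc_between S3 b a" using t arc_between_sym by blast
  moreover have "(S1 \<union> S2) \<inter> S3 = {b, a}" using t by auto
  ultimately show ?thesis using jordan_curve_union_arcs by blast
qed

text \<open>
  Two cuts along arcs: the arc from \<open>a\<close> through \<open>x\<close> to \<open>b\<close> splits off the part at the side \<open>S3\<close>; the
  remaining part is then split by the arc from \<open>x\<close> to \<open>c\<close>.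
\<close>

lemma trisect_inside:
  assumes tri: "triangular a b c S1 S2 S3" and x: "x \<in> inside (S1 \<union> S2 \<union> S3)"
    and G: "arc_between Ga x a" "arc_between Gb x b" "arc_between Gc x c"
    and sub: "Ga \<subseteq> insert a (inside (S1 \<union> S2 \<union> S3))" "Gb \<subseteq> insert b (inside (S1 \<union> S2 \<union> S3))"
      "Gc \<subseteq> insert c (inside (S1 \<union> S2 \<union> S3))"
    and int: "Ga \<inter> Gb = {x}" "Gb \<inter> Gc = {x}" "Gc \<inter> Ga = {x}"
  defines "f \<equiv> inside (S1 \<union> S2 \<union> S3)"
    and "fa \<equiv> inside (S1 \<union> Gc \<union> Gb)" and "fb \<equiv> inside (S2 \<union> Ga \<union> Gc)" and "fc \<equiv> inside (S3 \<union> Gb \<union> Ga)"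
  shows "triangular x b c S1 Gc Gb" "triangular a x c Gc S2 Ga" "triangular a b x Gb Ga S3"
    and "fa \<inter> fb = {}" "fb \<inter> fc = {}" "fc \<inter> fa = {}"
    and "fa \<union> fb \<union> fc = f - (Ga \<union> Gb \<union> Gc)"
proof -
  have t: "arc_between S1 b c" "arc_between S2 c a" "arc_between S3 a b"
     "S1 \<inter> S2 = {c}" "S2 \<inter> S3 = {a}" "S3 \<inter> S1 = {b}"
    using tri by (auto simp: triangular_def)
  have abc: "a \<noteq> b" "b \<noteq> c" "c \<noteq> a" using t arc_between_neq by blast+
  have mem: "a \<in> S2" "a \<in> S3" "b \<in> S1" "b \<in> S3" "c \<in> S1" "c \<in> S2" using t arc_between_ends by auto
  have memG: "x \<in> Ga" "x \<in> Gb" "x \<in> Gc" "a \<in> Ga" "b \<in> Gb" "c \<in> Gc" using G arc_between_ends by auto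
  have f0: "f \<inter> (S1 \<union> S2 \<union> S3) = {}" unfolding f_def using inside_no_overlap by blast
  have GS: "Ga \<inter> S1 = {}" "Ga \<inter> S2 = {a}" "Ga \<inter> S3 = {a}"
     "Gb \<inter> S1 = {b}" "Gb \<inter> S2 = {}" "Gb \<inter> S3 = {b}" "Gc \<inter> S1 = {c}" "Gc \<inter> S2 = {c}" "Gc \<inter> S3 = {}"
    using sub[folded f_def] f0 mem memG abc t(4-6) by auto
  note sy = arc_between_sym
  show ta: "triangular x b c S1 Gc Gb"
    using t G GS int by (auto simp: triangular_def sy)
  show tb: "triangular a x c Gc S2 Ga"
    using t G GS int by (auto simp: triangular_def sy)
  show tc: "triangular a b x Gb Ga S3"
    using t G GS int by (auto simp: triangular_def sy)
  have xS: "x \<notin> S1" "x \<notin> S2" "x \<notin> S3" using x f0 unfolding f_def by blast+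
  have arcs1: "arc_between S3 a b" "arc_between (S2 \<union> S1) a b" "arc_between (Ga \<union> Gb) a b"
    using arc_between_join[of S2 a c S1 b] arc_between_join[of Ga a x Gb b] t G int sy
    by (auto simp: Int_commute)
  have ints1: "S3 \<inter> (S2 \<union> S1) = {a, b}" "S3 \<inter> (Ga \<union> Gb) = {a, b}" "(S2 \<union> S1) \<inter> (Ga \<union> Gb) = {a, b}"
    using t GS by auto
  have ne1: "(Ga \<union> Gb) \<inter> inside (S3 \<union> (S2 \<union> S1)) \<noteq> {}"
    using x memG by (auto simp: Un_ac)
  have e: "S3 \<union> (S2 \<union> S1) = S1 \<union> S2 \<union> S3" "S3 \<union> (Ga \<union> Gb) = S3 \<union> Gb \<union> Ga" by auto
  let ?q = "inside ((S2 \<union> S1) \<union> (Ga \<union> Gb))"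
  have c1: "fc \<inter> ?q = {}" "fc \<union> ?q \<union> (Ga \<union> Gb - {a,b}) = f"
    using split_inside_arcs[OF arcs1 ints1 ne1] unfolding fc_def f_def e by auto
  \<comment> \<open>The third arc enters the part away from \<open>S3\<close>: it ends in \<open>c\<close>, which is not in the closure of the
    other part.\<close>
  have jc: "jordan_curve (S3 \<union> Gb \<union> Ga)" 
    using triangular_jordan[OF tc] by (simp add: Un_ac)
  have "closure fc = fc \<union> (S3 \<union> Gb \<union> Ga)"
    using jordan_curve_facts(11)[OF jc] closure_Un_frontier[of fc] unfolding fc_def by simp
  moreover have "c \<notin> f" using f0 mem by auto
  moreover have "c \<notin> S3 \<union> Gb \<union> Ga" using mem GS t abc by auto
  ultimately have "c \<notin> closure fc" using c1 by auto
  obtain g where g: "arc g" "path_image g = Gc" "pathstart g = x" "pathfinish g = c"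
    using G unfolding arc_between_def by blast
  have "c \<in> closure (Gc - {c})"
  proof -
    have "connected Gc" using g connected_arc_image by blast
    then have "c islimpt Gc" using memG xS mem
      by (intro connected_imp_perfect) auto
    then show ?thesis by (simp add: islimpt_in_closure)
  qed
  then have "(- closure fc) \<inter> (Gc - {c}) \<noteq> {}"
    using \<open>c \<notin> closure fc\<close> open_Int_closure_eq_empty[of "- closure fc" "Gc - {c}"] by auto
  then obtain y where y: "y \<in> Gc" "y \<noteq> c" "y \<notin> closure fc" by auto
  have "x \<in> closure fc"
    using \<open>closure fc = _\<close> memG by auto
  then have "y \<noteq> x" using y by auto
  have "y \<in> f" using y sub(3) by (auto simp: f_def)
  moreover have "y \<notin> Ga" using y \<open>y \<noteq> x\<close> int(3) by auto
  moreover have "y \<notin> Gb" using y \<open>y \<noteq> x\<close> int(2) by auto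
  moreover have "y \<notin> fc" using y closure_subset by auto
  ultimately have yq: "y \<in> ?q" unfolding c1(2)[symmetric] by auto
  have arcs2: "arc_between (Gb \<union> S1) x c" "arc_between (Ga \<union> S2) x c" "arc_between Gc x c"
    using arc_between_join[OF G(2) t(1) GS(4)] arc_between_join[OF G(1) _ GS(2), of c] t(2) G(3) sy by auto
  have ints2: "(Gb \<union> S1) \<inter> (Ga \<union> S2) = {x, c}" "(Gb \<union> S1) \<inter> Gc = {x, c}" "(Ga \<union> S2) \<inter> Gc = {x, c}"
    using t int GS by auto
  have e2: "Gb \<union> S1 \<union> (Ga \<union> S2) = (S2 \<union> S1) \<union> (Ga \<union> Gb)" "Gb \<union> S1 \<union> Gc = S1 \<union> Gc \<union> Gb" 
    "Ga \<union> S2 \<union> Gc = S2 \<union> Ga \<union> Gc" by auto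
  have ne2: "Gc \<inter> inside ((Gb \<union> S1) \<union> (Ga \<union> S2)) \<noteq> {}"
    using y yq e2 by auto
  have c2: "fa \<inter> fb = {}" "fa \<union> fb \<union> (Gc - {x, c}) = ?q"
    using split_inside_arcs[OF arcs2 ints2 ne2] unfolding fa_def fb_def e2 by auto
  show "fa \<inter> fb = {}" by fact
  show "fb \<inter> fc = {}" "fc \<inter> fa = {}" using c1 c2 by blast+
  have no: "fa \<inter> (S1 \<union> Gc \<union> Gb) = {}" "fb \<inter> (S2 \<union> Ga \<union> Gc) = {}" "fc \<inter> (S3 \<union> Gb \<union> Ga) = {}"
     "?q \<inter> ((S2 \<union> S1) \<union> (Ga \<union> Gb)) = {}"
    unfolding fa_def fb_def fc_def using inside_no_overlap by blast+
  have nf: "a \<notin> f" "b \<notin> f" "c \<notin> f" using f0 mem by auto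
  have "fa \<subseteq> f - Ga - Gb" "fb \<subseteq> f - Ga - Gb" using c1 c2 no(4) by blast+
  moreover have "fc \<inter> Gc = {}"
  proof -
    have "x \<notin> fc" "c \<notin> fc" using no(3) memG nf c1(2) by blast+
    moreover have "Gc - {x, c} \<subseteq> ?q" using c2(2) by auto
    ultimately show ?thesis using c1(1) by blast
  qed
  moreover have "fa \<inter> Gc = {}" "fb \<inter> Gc = {}" "fc \<inter> Ga = {}" "fc \<inter> Gb = {}" using no by blast+
  moreover have "fc \<subseteq> f" using c1 by auto
  ultimately have "fa \<union> fb \<union> fc \<subseteq> f - (Ga \<union> Gb \<union> Gc)" by blast
  moreover have "f - (Ga \<union> Gb \<union> Gc) \<subseteq> fa \<union> fb \<union> fc"
  proof
    fix y assume "y \<in> f - (Ga \<union> Gb \<union> Gc)"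
    then have "y \<in> fc \<union> ?q" "y \<notin> Gc" using c1(2) by blast+
    then show "y \<in> fa \<union> fb \<union> fc" using c2(2) by blast
  qed
  ultimately show "fa \<union> fb \<union> fc = f - (Ga \<union> Gb \<union> Gc)" by (rule equalityI)
qed

section \<open>Homeomorphisms of the plane\<close>

context
  fixes h g :: "complex \<Rightarrow> complex"
  assumes hom: "homeomorphism UNIV UNIV h g"
begin

lemma homeo_inj: "inj h"
  using hom by (metis UNIV_I homeomorphism_apply1 injI)

lemma homeo_bij: "bij h"
  using hom homeo_inj homeomorphism_image1[OF hom] by (simp add: bij_def)

lemma homeo_continuous: "continuous_on A h" "continuous_on A g"
  using hom continuous_on_subset unfolding homeomorphism_def by blast+

lemma homeo_image_cancel: "g ` h ` A = A" "h ` g ` A = A"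
  using hom by (auto simp: homeomorphism_def image_iff)

lemma homeo_compl: "h ` (- A) = - h ` A"
  by (rule bij_image_Compl_eq[OF homeo_bij])

lemma homeo_open: "open A \<Longrightarrow> open (h ` A)"
  using homeomorphism_imp_open_map[OF hom, of A] by (simp add: openin_subtopology)

lemma homeo_closed: "closed A \<Longrightarrow> closed (h ` A)"
  using homeo_open[of "- A"] by (simp add: closed_def homeo_compl)

lemma homeo_bounded_image: "bounded A \<Longrightarrow> bounded (h ` A)"
proof -
  assume "bounded A"
  then have "compact (h ` closure A)"
    by (intro compact_continuous_image homeo_continuous) (simp add: compact_closure)
  then show ?thesis
    by (meson bounded_subset closure_subset compact_imp_bounded image_mono)
qed

end

lemma homeo_bounded:
  assumes "homeomorphism UNIV UNIV h (g::complex\<Rightarrow>complex)"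
  shows "bounded (h ` A) \<longleftrightarrow> bounded (A :: complex set)"
  using homeo_bounded_image[OF assms] homeo_bounded_image[OF homeomorphism_symD[OF assms], of "h ` A"]
  by (auto simp: homeo_image_cancel[OF assms])

context
  fixes h g :: "complex \<Rightarrow> complex"
  assumes hom: "homeomorphism UNIV UNIV h g"
begin

lemma homeo_closure: "closure (h ` A) = h ` closure A"
proof
  show "closure (h ` A) \<subseteq> h ` closure A"
    by (intro closure_minimal image_mono closure_subset homeo_closed[OF hom] closed_closure)
  have "closure A \<subseteq> g ` closure (h ` A)"
    by (intro closure_minimal homeo_closed[OF homeomorphism_symD[OF hom]] closed_closure)
      (metis closure_subset homeo_image_cancel(1)[OF hom] image_mono)
  then show "h ` closure A \<subseteq> closure (h ` A)"
    by (metis homeo_image_cancel(2)[OF hom] image_mono)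
qed

lemma homeo_frontier: "frontier (h ` A) = h ` frontier A"
  unfolding frontier_closures homeo_closure homeo_compl[OF hom, symmetric]
  by (simp add: image_Int[OF homeo_inj[OF hom]])

lemma homeo_components:
  assumes "open U"
  shows "components (h ` U) = (`) h ` components U"
proof (rule components_eq_open_partition)
  show "\<Union> ((`) h ` components U) = h ` U" by (metis Union_components image_Union)
  show "pairwise disjnt ((`) h ` components U)"
    using pairwise_disjoint_components[of U] homeo_inj[OF hom]
    unfolding pairwise_def disjnt_def by (auto simp flip: image_Int)
  show "open C \<and> connected C \<and> C \<noteq> {}" if "C \<in> (`) h ` components U" for C
    using that homeo_open[OF hom] homeo_continuous[OF hom] open_components[OF assms]
    by (auto intro!: connected_continuous_image dest: in_components_connected in_components_nonempty)
qed

text \<open>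
  In this form the inside of a set is visibly transported by homeomorphisms.
\<close>

lemma inside_eq_bounded_components: "inside S = \<Union>{C \<in> components (- S). bounded C}" for S :: "complex set"
proof (intro equalityI subsetI)
  fix x assume x: "x \<in> inside S"
  then have "x \<in> connected_component_set (- S) x" "connected_component_set (- S) x \<in> components (- S)"
    by (auto simp: inside_def componentsI)
  then show "x \<in> \<Union>{C \<in> components (- S). bounded C}"
    using x unfolding inside_def by blast
next
  fix x assume "x \<in> \<Union>{C \<in> components (- S). bounded C}"
  then obtain y where "x \<in> connected_component_set (- S) y" "bounded (connected_component_set (- S) y)"
    by (auto elim!: componentsE)
  then show "x \<in> inside S"
    using connected_component_eq[of x "- S" y] connected_component_in unfolding inside_def by fastforce
qed

lemma homeo_inside:
  assumes "closed S" shows "inside (h ` S) = h ` inside S"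
proof -
  have "components (- h ` S) = (`) h ` components (- S)"
    using homeo_components[of "- S"] assms by (simp add: homeo_compl[OF hom] open_Compl)
  then show ?thesis
    unfolding inside_eq_bounded_components using homeo_bounded[OF hom] by auto blast+
qed

lemma homeo_arc_between: "arc_between S a b \<Longrightarrow> arc_between (h ` S) (h a) (h b)"
  unfolding arc_between_def
proof (elim exE conjE)
  fix p assume p: "arc p" "path_image p = S" "pathstart p = a" "pathfinish p = b"
  have "arc (h \<circ> p)"
    using p(1) path_continuous_image[of p h] homeo_continuous(1)[OF hom] homeo_inj[OF hom]
    unfolding arc_def by (auto intro: comp_inj_on inj_on_subset)
  then show "\<exists>p. arc p \<and> path_image p = h ` S \<and> pathstart p = h a \<and> pathfinish p = h b"
    using p by (intro exI[of _ "h \<circ> p"]) (simp add: path_image_compose pathstart_compose pathfinish_compose)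
qed

lemma homeo_triangular:
  assumes "triangular a b c S1 S2 S3"
  shows "triangular (h a) (h b) (h c) (h ` S1) (h ` S2) (h ` S3)"
  using assms homeo_arc_between unfolding triangular_def
  by (auto simp: image_Int[OF homeo_inj[OF hom], symmetric])

end

section \<open>Triangular faces\<close>

text \<open>
  The sides meet the vertices of the map only in the corners, so that the corners are exactly the
  vertices on the boundary of the face, and a straight side is the segment between two corners.
\<close>

definition tri_face :: "emap \<Rightarrow> complex set \<Rightarrow> complex \<Rightarrow> complex \<Rightarrow> complex \<Rightarrow> bool" where
  "tri_face m f a b c \<longleftrightarrow> (\<exists>S1 S2 S3. triangular a b c S1 S2 S3 \<and> f = inside (S1 \<union> S2 \<union> S3) \<and>
     {S1, S2, S3} \<subseteq> edges m \<and> verts m \<inter> S1 = {b, c} \<and> verts m \<inter> S2 = {c, a} \<and> verts m \<inter> S3 = {a, b})"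

lemma tri_faceI:
  assumes "triangular a b c S1 S2 S3" "f = inside (S1 \<union> S2 \<union> S3)"
    "S1 \<in> edges m" "S2 \<in> edges m" "S3 \<in> edges m"
    "verts m \<inter> S1 = {b, c}" "verts m \<inter> S2 = {c, a}" "verts m \<inter> S3 = {a, b}"
  shows "tri_face m f a b c"
  using assms unfolding tri_face_def by blast

lemma tri_face_corners:
  assumes "tri_face m f a b c"
  shows "face_verts m f = {a, b, c}" "a \<noteq> b" "b \<noteq> c" "c \<noteq> a" "{a, b, c} \<subseteq> verts m"
    "open f" "connected f" "f \<noteq> {}" "bounded f"
proof -
  obtain S1 S2 S3 where t: "triangular a b c S1 S2 S3" "f = inside (S1 \<union> S2 \<union> S3)"
     "verts m \<inter> S1 = {b, c}" "verts m \<inter> S2 = {c, a}" "verts m \<inter> S3 = {a, b}"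
    using assms unfolding tri_face_def by blast
  note j = jordan_curve_facts[OF triangular_jordan[OF t(1)]]
  show "face_verts m f = {a, b, c}" unfolding face_verts_def t(2) j(11) using t(3-5) by auto
  show "a \<noteq> b" "b \<noteq> c" "c \<noteq> a" using t(1) arc_between_neq unfolding triangular_def by blast+
  show "{a, b, c} \<subseteq> verts m" using t(3-5) by auto
  show "open f" "connected f" "f \<noteq> {}" "bounded f" using j t(2) by auto
qed

lemma image_emap_simps [simp]:
  "verts (image_emap h m) = h ` verts m" "edges (image_emap h m) = (`) h ` edges m"
  by (auto simp: image_emap_def)

lemma support_image_emap: "support (image_emap h m) = h ` support m"
  by (auto simp: support_def)

context
  fixes h g :: "complex \<Rightarrow> complex"
  assumes hom: "homeomorphism UNIV UNIV h g"
begin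

lemma faces_image_emap:
  assumes "closed (support m)" shows "faces (image_emap h m) = (`) h ` faces m"
  using homeo_components[OF hom, of "- support m"] assms
  by (simp add: faces_def support_image_emap homeo_compl[OF hom] open_Compl)

lemma finite_faces_image_emap:
  assumes "closed (support m)" shows "finite_faces (image_emap h m) = (`) h ` finite_faces m"
  unfolding finite_faces_def faces_image_emap[OF assms] using homeo_bounded[OF hom] by auto

lemma adj_image_emap: "adj (image_emap h m) = map_prod h h ` adj m"
proof -
  note inj = homeo_inj[OF hom]
  have *: "h ` verts m \<inter> h ` e = {h u, h v} \<longleftrightarrow> verts m \<inter> e = {u, v}" for e u v
    using image_Int[OF inj, of "verts m" e, symmetric] inj_image_eq_iff[OF inj, of "verts m \<inter> e" "{u, v}"] by simp
  show ?thesis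
  proof (intro equalityI subrelI)
    fix u v assume "(u, v) \<in> adj (image_emap h m)"
    moreover obtain u' v' where "u = h u'" "v = h v'" using homeo_bij[OF hom] by (meson bij_pointE)
    ultimately show "(u, v) \<in> map_prod h h ` adj m"
      by (auto simp: adj_def * intro!: image_eqI[of _ _ "(u', v')"])
  next
    fix u v assume "(u, v) \<in> map_prod h h ` adj m"
    then show "(u, v) \<in> adj (image_emap h m)"
      using inj by (fastforce simp: adj_def * inj_eq)
  qed
qed

lemma tri_face_image_emap:
  assumes "tri_face m f a b c" shows "tri_face (image_emap h m) (h ` f) (h a) (h b) (h c)"
proof -
  obtain S1 S2 S3 where t: "triangular a b c S1 S2 S3" "f = inside (S1 \<union> S2 \<union> S3)" "{S1, S2, S3} \<subseteq> edges m"
     "verts m \<inter> S1 = {b, c}" "verts m \<inter> S2 = {c, a}" "verts m \<inter> S3 = {a, b}"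
    using assms unfolding tri_face_def by blast
  have "closed (S1 \<union> S2 \<union> S3)"
    using t(1) arc_between_closed unfolding triangular_def by blast
  then have "h ` f = inside (h ` S1 \<union> h ` S2 \<union> h ` S3)"
    unfolding t(2) by (simp add: homeo_inside[OF hom, symmetric] image_Un)
  moreover have "h ` verts m \<inter> h ` S1 = {h b, h c}" "h ` verts m \<inter> h ` S2 = {h c, h a}" "h ` verts m \<inter> h ` S3 = {h a, h b}"
    using t(4-6) by (auto simp: image_Int[OF homeo_inj[OF hom], symmetric])
  ultimately show ?thesis
    using homeo_triangular[OF hom t(1)] t(3) unfolding tri_face_def
    by (intro exI[of _ "h ` S1"] exI[of _ "h ` S2"] exI[of _ "h ` S3"]) auto
qed

end

section \<open>Inserting a vertex\<close>

text \<open>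
  The effect of an insertion, for arbitrary drawings: one face is exchanged for three, each of them
  obtained by replacing one corner with the new vertex, and the rest of the map is untouched. The
  three new faces come from \<open>trisect_inside\<close>; they are recognized as components by
  \<open>components_eq_open_partition\<close>.
\<close>

lemma insertion_faces:
  assumes cl: "closed (support m)" and f: "f \<in> faces m" and tf: "tri_face m f a b c"
    and ins: "insertion m f m'"
  obtains x fa fb fc where "x \<in> f" "verts m' = insert x (verts m)"
    "faces m' = faces m - {f} \<union> {fa, fb, fc}" "fa \<noteq> fb" "fb \<noteq> fc" "fc \<noteq> fa" "{fa, fb, fc} \<inter> faces m \<subseteq> {f}"
    "tri_face m' fa x b c" "tri_face m' fb a x c" "tri_face m' fc a b x"
    "\<And>g p q r. tri_face m g p q r \<Longrightarrow> tri_face m' g p q r"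
    "adj m' = adj m \<union> {x} \<times> {a, b, c} \<union> {a, b, c} \<times> {x}"
    "closed (support m')"
proof -
  obtain S1 S2 S3 where t: "triangular a b c S1 S2 S3" "f = inside (S1 \<union> S2 \<union> S3)" "{S1, S2, S3} \<subseteq> edges m"
     "verts m \<inter> S1 = {b, c}" "verts m \<inter> S2 = {c, a}" "verts m \<inter> S3 = {a, b}"
    using tf unfolding tri_face_def by blast
  note fv = tri_face_corners[OF tf]
  obtain x \<gamma> where x: "x \<in> f"
    and g: "\<forall>v \<in> {a, b, c}. arc (\<gamma> v) \<and> pathstart (\<gamma> v) = x \<and> pathfinish (\<gamma> v) = v \<and> path_image (\<gamma> v) \<subseteq> insert v f"
    and gi: "\<forall>v \<in> {a, b, c}. \<forall>w \<in> {a, b, c}. v \<noteq> w \<longrightarrow> path_image (\<gamma> v) \<inter> path_image (\<gamma> w) = {x}"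
    and m': "m' = \<lparr>verts = insert x (verts m), edges = edges m \<union> (\<lambda>v. path_image (\<gamma> v)) ` {a, b, c}, root = root m\<rparr>"
    using ins[unfolded insertion_def fv(1)] by (elim bexE exE conjE) (rule that)
  define Ga where "Ga = path_image (\<gamma> a)"
  define Gb where "Gb = path_image (\<gamma> b)"
  define Gc where "Gc = path_image (\<gamma> c)"
  have G: "arc_between Ga x a" "arc_between Gb x b" "arc_between Gc x c"
    unfolding arc_between_def Ga_def Gb_def Gc_def using g by blast+
  have Gs: "Ga \<subseteq> insert a f" "Gb \<subseteq> insert b f" "Gc \<subseteq> insert c f"
    unfolding Ga_def Gb_def Gc_def using g by blast+
  have Gi: "Ga \<inter> Gb = {x}" "Gb \<inter> Gc = {x}" "Gc \<inter> Ga = {x}"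
    unfolding Ga_def Gb_def Gc_def using gi fv by auto
  have vm': "verts m' = insert x (verts m)" and em': "edges m' = edges m \<union> {Ga, Gb, Gc}"
    unfolding m' Ga_def Gb_def Gc_def by auto
  define fa where "fa = inside (S1 \<union> Gc \<union> Gb)"
  define fb where "fb = inside (S2 \<union> Ga \<union> Gc)"
  define fc where "fc = inside (S3 \<union> Gb \<union> Ga)"
  note tr = trisect_inside[OF t(1) x[unfolded t(2)] G Gs[unfolded t(2)] Gi, folded fa_def fb_def fc_def t(2)]
  have disj: "f \<inter> support m = {}" using f in_components_subset unfolding faces_def by blast
  have xm: "x \<notin> support m" using x disj by blast
  have vold: "verts m' \<inter> e = verts m \<inter> e" if "e \<in> edges m" for e
    using that xm unfolding vm' support_def by auto
  have xG: "x \<in> Ga" "x \<in> Gb" "x \<in> Gc" "a \<in> Ga" "b \<in> Gb" "c \<in> Gc"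
    using G arc_between_ends by blast+
  have vf: "verts m \<inter> f = {}" using disj unfolding support_def by blast
  have vG: "verts m' \<inter> Ga = {x, a}" "verts m' \<inter> Gb = {x, b}" "verts m' \<inter> Gc = {x, c}"
    unfolding vm' using vf Gs xG fv(5) by auto
  have old: "tri_face m' h p q r" if "tri_face m h p q r" for h p q r
  proof -
    obtain T1 T2 T3 where T: "triangular p q r T1 T2 T3" "h = inside (T1 \<union> T2 \<union> T3)" "{T1, T2, T3} \<subseteq> edges m"
     "verts m \<inter> T1 = {q, r}" "verts m \<inter> T2 = {r, p}" "verts m \<inter> T3 = {p, q}"
      using \<open>tri_face m h p q r\<close> unfolding tri_face_def by blast
    show ?thesis
      by (rule tri_faceI[OF T(1,2)]) (use T(3-6) vold in \<open>auto simp: em'\<close>)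
  qed
  have vS: "verts m' \<inter> S1 = {b, c}" "verts m' \<inter> S2 = {c, a}" "verts m' \<inter> S3 = {a, b}"
    using vold t by auto
  have ta: "tri_face m' fa x b c"
    by (rule tri_faceI[OF tr(1)]) (use vS vG t(3) in \<open>auto simp: em' fa_def\<close>)
  have tb: "tri_face m' fb a x c"
    by (rule tri_faceI[OF tr(2)]) (use vS vG t(3) in \<open>auto simp: em' fb_def Un_ac\<close>)
  have tc: "tri_face m' fc a b x"
    by (rule tri_faceI[OF tr(3)]) (use vS vG t(3) in \<open>auto simp: em' fc_def Un_ac\<close>)
  note na = tri_face_corners(6-8)[OF ta] and nb = tri_face_corners(6-8)[OF tb] and nc = tri_face_corners(6-8)[OF tc]
  have abc: "a \<in> support m" "b \<in> support m" "c \<in> support m" using fv(5) unfolding support_def by auto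
  have sup: "support m' = support m \<union> (Ga \<union> Gb \<union> Gc)"
    using xG unfolding support_def vm' em' by auto
  have fa: "faces m' = faces m - {f} \<union> {fa, fb, fc}"
    unfolding faces_def[of m']
  proof (rule components_eq_open_partition)
    have "\<Union> (faces m) = - support m" unfolding faces_def by simp
    moreover have dis: "X \<inter> Y = {}" if "X \<in> faces m" "Y \<in> faces m" "X \<noteq> Y" for X Y
      using that components_nonoverlap unfolding faces_def by blast
    moreover have "\<Union> (faces m) = f \<union> \<Union> (faces m - {f})" using f by auto
    moreover have "f \<inter> \<Union> (faces m - {f}) = {}" using f dis by auto
    ultimately have U: "\<Union> (faces m - {f}) = - support m - f" by auto
    have "\<Union> (faces m - {f} \<union> {fa, fb, fc}) = (- support m - f) \<union> (f - (Ga \<union> Gb \<union> Gc))"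
      using U tr(7) by auto
    also have "\<dots> = - support m'" unfolding sup using Gs disj abc by blast
    finally show "\<Union> (faces m - {f} \<union> {fa, fb, fc}) = - support m'" .
    have sub: "fa \<subseteq> f" "fb \<subseteq> f" "fc \<subseteq> f" using tr(7) by auto
    have d1: "disjnt X Y" if "X \<in> faces m - {f}" "Y \<in> {fa, fb, fc}" for X Y
    proof -
      have "X \<inter> f = {}" "Y \<subseteq> f" using that sub f dis by auto
      then show ?thesis by (auto simp: disjnt_def)
    qed
    have d2: "disjnt X Y" if "X \<in> {fa, fb, fc}" "Y \<in> {fa, fb, fc}" "X \<noteq> Y" for X Y
      using that tr(4-6) by (auto simp: disjnt_def)
    have d3: "disjnt X Y" if "X \<in> faces m - {f}" "Y \<in> faces m - {f}" "X \<noteq> Y" for X Y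
      using that dis by (auto simp: disjnt_def)
    show "pairwise disjnt (faces m - {f} \<union> {fa, fb, fc})"
    proof (rule pairwiseI, elim UnE)
      fix X Y assume "X \<in> {fa, fb, fc}" "Y \<in> faces m - {f}"
      then show "disjnt X Y" by (intro disjnt_sym[OF d1])
    qed (rule d1 d2 d3; assumption)+
    show "open C \<and> connected C \<and> C \<noteq> {}" if "C \<in> faces m - {f} \<union> {fa, fb, fc}" for C
    proof (cases "C \<in> faces m")
      case True
      then show ?thesis
        using cl open_components[of "- support m" C] in_components_connected in_components_nonempty
        unfolding faces_def by auto
    qed (use that na nb nc in auto)
  qed
  have "adj m' = adj m \<union> {x} \<times> {a, b, c} \<union> {a, b, c} \<times> {x}" (is "_ = ?R")
  proof (intro equalityI subrelI)
    fix u v assume uv: "(u, v) \<in> adj m'"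
    then obtain e where e: "u \<noteq> v" "e \<in> edges m \<union> {Ga, Gb, Gc}" "verts m' \<inter> e = {u, v}"
      unfolding adj_def em' by auto
    show "(u, v) \<in> ?R"
    proof (cases "e \<in> edges m")
      case True
      then show ?thesis using e vold unfolding adj_def by auto
    next
      case False
      then consider "e = Ga" | "e = Gb" | "e = Gc" using e(2) by blast
      then consider "{u, v} = {x, a}" | "{u, v} = {x, b}" | "{u, v} = {x, c}"
        by cases (use e(3) vG in simp_all)
      then show ?thesis by cases (simp_all add: doubleton_eq_iff, auto)
    qed
  next
    have adjI: "(p, q) \<in> adj m'" "(q, p) \<in> adj m'" if "e \<in> edges m'" "verts m' \<inter> e = {p, q}" "p \<noteq> q" for e p q
      using that unfolding adj_def by (auto simp: insert_commute)
    have "x \<noteq> a" "x \<noteq> b" "x \<noteq> c" using fv(5) vf x by auto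
    then have new: "(x, a) \<in> adj m'" "(a, x) \<in> adj m'" "(x, b) \<in> adj m'" "(b, x) \<in> adj m'"
      "(x, c) \<in> adj m'" "(c, x) \<in> adj m'"
      using adjI[OF _ vG(1)] adjI[OF _ vG(2)] adjI[OF _ vG(3)] unfolding em' by simp_all
    have "adj m \<subseteq> adj m'"
      using vold unfolding adj_def em' by auto
    then show "\<And>u v. (u, v) \<in> ?R \<Longrightarrow> (u, v) \<in> adj m'" using new by auto
  qed
  moreover have "closed (support m')"
    unfolding sup using cl G arc_between_closed by blast
  moreover have "fa \<noteq> fb" "fb \<noteq> fc" "fc \<noteq> fa" using tr(4-6) na nb nc by auto
  moreover have "{fa, fb, fc} \<inter> faces m \<subseteq> {f}"
  proof -
    have "X = f" if "X \<in> faces m" "X \<subseteq> f" for X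
      using that f components_eq[of X "- support m" f] in_components_nonempty[of X] unfolding faces_def by blast
    then show ?thesis using tr(7) by blast
  qed
  ultimately show thesis using that[OF x vm' fa] ta tb tc old by blast
qed

text \<open>
  Two segments that meet again after their start lie on a common ray, so the end of the shorter one
  would be an inner point of the longer one.
\<close>

lemma segments_from_inner_point_meet_only_there:
  fixes x v w :: "'a::euclidean_space"
  assumes "open_segment x v \<subseteq> F" "open_segment x w \<subseteq> F" "v \<notin> F" "w \<notin> F" "v \<noteq> w" "x \<in> F"
  shows "closed_segment x v \<inter> closed_segment x w = {x}"
proof -
  have False if y: "y \<in> closed_segment x v" "y \<in> closed_segment x w" "y \<noteq> x" for y
  proof -
    have *: False if sv: "0 \<le> s" "s \<le> 1" "y = (1 - s) *\<^sub>R x + s *\<^sub>R v" and tw: "0 \<le> t" "t \<le> 1" "y = (1 - t) *\<^sub>R x + t *\<^sub>R w"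
      and "s \<le> t" "v \<noteq> w" and F: "open_segment x v \<subseteq> F" "w \<notin> F" "x \<in> F" for s t v w
    proof -
      have "s \<noteq> 0" using sv \<open>y \<noteq> x\<close> by auto
      then have "t > 0" using sv \<open>s \<le> t\<close> by auto
      have "t *\<^sub>R (w - x) = s *\<^sub>R (v - x)" using sv(3) tw(3) by (simp add: algebra_simps)
      then have "inverse t *\<^sub>R (t *\<^sub>R (w - x)) = inverse t *\<^sub>R (s *\<^sub>R (v - x))" by simp
      then have "w - x = (s / t) *\<^sub>R (v - x)" using \<open>t > 0\<close> by (simp add: divide_inverse mult.commute)
      then have "w = (1 - s / t) *\<^sub>R x + (s / t) *\<^sub>R v" by (simp add: algebra_simps)
      moreover have "0 \<le> s / t" "s / t \<le> 1" using \<open>t > 0\<close> sv \<open>s \<le> t\<close> by auto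
      ultimately have "w \<in> closed_segment x v" unfolding closed_segment_def by blast
      then show False using F \<open>v \<noteq> w\<close> unfolding open_segment_def by auto
    qed
    obtain s t where "0 \<le> s" "s \<le> 1" "y = (1 - s) *\<^sub>R x + s *\<^sub>R v" "0 \<le> t" "t \<le> 1" "y = (1 - t) *\<^sub>R x + t *\<^sub>R w"
      using y unfolding closed_segment_def by blast
    then show False
      using *[of s v t w] *[of t w s v] assms by (cases "s \<le> t") auto
  qed
  then show ?thesis by auto
qed

lemma straight_edge_eq_segment:
  assumes "straight m" "e \<in> edges m" "verts m \<inter> e = {u, v}" "u \<noteq> v"
  shows "e = closed_segment u v"
proof -
  obtain p q where "p \<in> verts m" "q \<in> verts m" "e = closed_segment p q"
    using assms(1,2) unfolding straight_def by blast
  then have "{p, q} \<subseteq> {u, v}" using assms(3) by auto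
  moreover have "p \<noteq> q"
  proof
    assume "p = q"
    then have "{u, v} \<subseteq> {p}" using assms(3) \<open>e = _\<close> by auto
    then show False using assms(4) by auto
  qed
  ultimately have "(p = u \<and> q = v) \<or> (p = v \<and> q = u)" by auto
  then show ?thesis using \<open>e = _\<close> closed_segment_commute by blast
qed

text \<open>
  In a straight drawing the face is the interior of the convex hull of its corners. Any of its points
  can be joined to the corners by segments.
\<close>

lemma straight_insertion_exists:
  assumes st: "straight m" and tf: "tri_face m f a b c"
  shows "\<exists>m'. insertion m f m' \<and> straight m'"
proof -
  obtain S1 S2 S3 where t: "triangular a b c S1 S2 S3" "f = inside (S1 \<union> S2 \<union> S3)" "{S1, S2, S3} \<subseteq> edges m"
     "verts m \<inter> S1 = {b, c}" "verts m \<inter> S2 = {c, a}" "verts m \<inter> S3 = {a, b}"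
    using tf unfolding tri_face_def by blast
  note fv = tri_face_corners[OF tf]
  have "S1 = closed_segment b c" "S2 = closed_segment c a" "S3 = closed_segment a b"
    using straight_edge_eq_segment[OF st] t fv by auto
  then have "f = inside (closed_segment a b \<union> closed_segment b c \<union> closed_segment c a)"
    unfolding t(2) by (simp add: Un_ac)
  then have f: "f = interior (convex hull {a, b, c})"
    using inside_of_triangle[of a b c] by simp
  obtain x where x: "x \<in> f" using fv(8) by blast
  have seg: "open_segment x v \<subseteq> f" if "v \<in> {a, b, c}" for v
    unfolding f using that x f
    by (intro in_interior_closure_convex_segment) (auto intro: hull_inc closure_subset[THEN subsetD])
  have nf: "v \<notin> f" if "v \<in> {a, b, c}" for v
    using that fv(1,6) unfolding face_verts_def by (auto simp: frontier_def interior_open)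
  define \<gamma> where "\<gamma> v = linepath x v" for v :: complex
  let ?m' = "\<lparr>verts = insert x (verts m), edges = edges m \<union> (\<lambda>v. path_image (\<gamma> v)) ` face_verts m f, root = root m\<rparr>"
  have "insertion m f ?m'"
    unfolding insertion_def
  proof (intro bexI[OF _ x] exI[of _ \<gamma>] conjI ballI impI)
    fix v assume v: "v \<in> face_verts m f"
    then have v': "v \<in> {a, b, c}" using fv by simp
    then have "x \<noteq> v" using x nf by blast
    then show "arc (\<gamma> v)" "pathstart (\<gamma> v) = x" "pathfinish (\<gamma> v) = v" unfolding \<gamma>_def by auto
    show "path_image (\<gamma> v) \<subseteq> insert v f"
      using seg[OF v'] x unfolding \<gamma>_def open_segment_def by auto
    fix w assume w: "w \<in> face_verts m f" "v \<noteq> w"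
    then have w': "w \<in> {a, b, c}" using fv by simp
    show "path_image (\<gamma> v) \<inter> path_image (\<gamma> w) = {x}"
      using segments_from_inner_point_meet_only_there[OF seg[OF v'] seg[OF w'] nf[OF v'] nf[OF w'] w(2) x]
      unfolding \<gamma>_def by simp
  qed simp
  moreover have "straight ?m'"
    unfolding straight_def
  proof
    fix e assume "e \<in> edges ?m'"
    then consider "e \<in> edges m" | v where "v \<in> {a, b, c}" "e = closed_segment x v"
      unfolding fv(1) \<gamma>_def by auto
    then show "\<exists>u \<in> verts ?m'. \<exists>v \<in> verts ?m'. e = closed_segment u v"
    proof cases
      case 1
      then show ?thesis using st unfolding straight_def by fastforce
    next
      case 2
      moreover have "x \<in> verts ?m'" "v \<in> verts ?m'" using fv(5) 2 by auto
      ultimately show ?thesis by blast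
    qed
  qed
  ultimately show ?thesis by blast
qed

lemma orientation_preserving_homeo_id: "orientation_preserving_homeo id"
  unfolding orientation_preserving_homeo_def
  by (auto simp: winding_number_circlepath_centre homeomorphism_def intro!: exI[of _ id])

lemma image_emap_id: "image_emap id m = m"
  by (cases m) (simp add: image_emap_def map_prod.id)

lemma in_rooted_map_of: "m \<in> rooted_map_of m"
  unfolding rooted_map_of_def using orientation_preserving_homeo_id image_emap_id[of m] by (metis (mono_tags, lifting) mem_Collect_eq)

section \<open>The rooted triangle\<close>

lemma triangle_sides:
  "closed_segment 1 \<i> = {z. Re z \<ge> 0 \<and> Im z \<ge> 0 \<and> Re z + Im z = 1}"
  "closed_segment \<i> 0 = {z. Re z = 0 \<and> Im z \<ge> 0 \<and> Im z \<le> 1}"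
  "closed_segment 0 1 = {z. Im z = 0 \<and> Re z \<ge> 0 \<and> Re z \<le> 1}"
  subgoal by (auto simp: closed_segment_def complex_eq_iff intro!: exI[of _ "Im _"])
  subgoal
  proof (intro equalityI subsetI)
    fix z assume "z \<in> {z. Re z = 0 \<and> Im z \<ge> 0 \<and> Im z \<le> 1}"
    then show "z \<in> closed_segment \<i> 0"
      by (auto simp: closed_segment_def complex_eq_iff intro!: exI[of _ "1 - Im z"])
  qed (auto simp: closed_segment_def)
  subgoal by (auto simp: closed_segment_def complex_eq_iff intro!: exI[of _ "Re _"])
  done

lemma triangle_segments:
  "triangular 0 1 \<i> (closed_segment 1 \<i>) (closed_segment \<i> 0) (closed_segment 0 1)"
  unfolding triangular_def
proof (intro conjI arc_between_segment)
  show "closed_segment 1 \<i> \<inter> closed_segment \<i> 0 = {\<i>}" "closed_segment \<i> 0 \<inter> closed_segment 0 1 = {0}"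
    "closed_segment 0 1 \<inter> closed_segment 1 \<i> = {1}"
    unfolding triangle_sides by (auto simp: complex_eq_iff)
qed auto

lemma triangle_verts_segments:
  "verts triangle \<inter> closed_segment 1 \<i> = {1, \<i>}" "verts triangle \<inter> closed_segment \<i> 0 = {\<i>, 0}"
  "verts triangle \<inter> closed_segment 0 1 = {0, 1}"
  unfolding triangle_sides by (auto simp: triangle_def complex_eq_iff)

lemma triangle_tri_face:
  defines "C \<equiv> closed_segment 1 \<i> \<union> closed_segment \<i> 0 \<union> closed_segment 0 1"
  shows "tri_face triangle (inside C) 0 1 \<i>" "faces triangle = {inside C, outside C}"
    "closed (support triangle)" "\<not> bounded (outside C)" "frontier (outside C) = C" "verts triangle \<subseteq> C" 
proof -
  note j = jordan_curve_facts[OF triangular_jordan[OF triangle_segments], folded C_def]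
  show "tri_face triangle (inside C) 0 1 \<i>"
    by (rule tri_faceI[OF triangle_segments]) (use triangle_verts_segments in \<open>auto simp: C_def triangle_def\<close>)
  have sup: "support triangle = C"
    unfolding support_def C_def by (auto simp: triangle_def)
  show "faces triangle = {inside C, outside C}"
    unfolding faces_def sup
    by (rule components_eq_open_partition) (use j(1-10) in \<open>auto simp: pairwise_insert disjnt_def Int_commute\<close>)
  show "closed (support triangle)" unfolding sup C_def by (intro closed_Un closed_segment)
  show "\<not> bounded (outside C)" "frontier (outside C) = C" using j by auto
  show "verts triangle \<subseteq> C" unfolding C_def by (auto simp: triangle_def)
qed

lemma adj_triangle: "adj triangle = {0, 1, \<i>} \<times> {0, 1, \<i>} - Id"
proof -
  have "adj triangle = {(u, v). u \<noteq> v \<and> ({1, \<i>} = {u, v} \<or> {\<i>, 0} = {u, v} \<or> {0, 1} = {u, v})}"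
    unfolding adj_def triangle_verts_segments[symmetric] by (auto simp: triangle_def)
  then show ?thesis by (auto simp: doubleton_eq_iff)
qed

lemma straight_triangle: "straight triangle"
  unfolding straight_def triangle_def by auto

section \<open>Increasing ternary trees\<close>

datatype corner = C0 | C1 | C2

lemma UNIV_corner: "UNIV = {C0, C1, C2}"
  by (auto intro: corner.exhaust)

instance corner :: finite
  by standard (simp add: UNIV_corner)

lemma all_corner: "(\<forall>i. P i) \<longleftrightarrow> P C0 \<and> P C1 \<and> P C2"
  by (metis corner.exhaust)

lemma sum_corner: "(\<Sum>i\<in>UNIV. f i) = f C0 + f C1 + f C2" for f :: "corner \<Rightarrow> 'a::comm_monoid_add"
  by (simp add: UNIV_corner add.assoc)

lemma card_corner: "card (UNIV :: corner set) = 3"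
  by (simp add: UNIV_corner)

text \<open>
  A node inserted into the face with address \<open>w\<close> is named \<open>Inner w\<close>.
\<close>

datatype node = Outer corner | Inner "corner list"

text \<open>
  Words are read from the root, so a child of \<open>u\<close> is \<open>u @ [c]\<close>; the recursion has to run over the
  reversed word. In the child \<open>u @ [c]\<close> the corner \<open>c\<close> is the new node and the other two are inherited
  (\<open>corner_node_simps\<close>).
\<close>

primrec rev_corner_node :: "corner list \<Rightarrow> corner \<Rightarrow> node" where
  "rev_corner_node [] i = Outer i"
| "rev_corner_node (c # r) i = (if i = c then Inner (rev r) else rev_corner_node r i)"

definition corner_node :: "corner list \<Rightarrow> corner \<Rightarrow> node" where
  "corner_node u = rev_corner_node (rev u)"

lemma corner_node_simps [simp]:
  "corner_node [] i = Outer i"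
  "corner_node (u @ [c]) i = (if i = c then Inner u else corner_node u i)"
  by (simp_all add: corner_node_def)

definition grow :: "corner list set \<Rightarrow> corner list \<Rightarrow> corner list set" where
  "grow L s = (L - {s}) \<union> range (\<lambda>c. s @ [c])"

text \<open>
  The first argument collects the internal nodes, the second one the leaves.
\<close>

inductive tree :: "corner list set \<Rightarrow> corner list set \<Rightarrow> bool" where
  tree_root: "tree {} {[]}"
| tree_grow: "tree I L \<Longrightarrow> s \<in> L \<Longrightarrow> tree (insert s I) (grow L s)"

definition tree_nodes :: "corner list set \<Rightarrow> node set" where
  "tree_nodes I = range Outer \<union> Inner ` I"

definition tree_adj :: "corner list set \<Rightarrow> node rel" where
  "tree_adj I = {(Outer i, Outer j) | i j. i \<noteq> j} \<union>
     (\<Union>w \<in> I. \<Union>i. {(Inner w, corner_node w i), (corner_node w i, Inner w)})"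

lemma tree_finite: "tree I L \<Longrightarrow> finite I \<and> finite L"
  by (induction rule: tree.induct) (auto simp: grow_def)

lemma tree_prefix_free:
  assumes "tree I L" "u \<in> L" "v \<in> L" "u \<noteq> v" shows "u \<parallel> v"
  using assms
proof (induction arbitrary: u v rule: tree.induct)
  case (tree_grow I L s)
  have *: "(s @ [c]) \<parallel> v" if "v \<in> L" "v \<noteq> s" for v c
    using tree_grow.IH[OF \<open>s \<in> L\<close> that(1)] that(2) by (auto simp: parallel_def prefix_snoc dest: append_prefixD)
  show ?case
    using tree_grow.prems tree_grow.IH * parallel_commute unfolding grow_def by (auto simp: parallel_def) 
qed auto

lemma tree_leaf_not_prefix_of_internal:
  assumes "tree I L" "u \<in> L" "w \<in> I" shows "\<not> prefix u w"
  using assms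
proof (induction arbitrary: u w rule: tree.induct)
  case (tree_grow I L s)
  have "\<not> prefix s w" if "w \<in> I" for w using tree_grow that by blast
  moreover have "\<not> prefix u s" if "u \<in> L" "u \<noteq> s" for u
    using tree_prefix_free[OF tree_grow.hyps(1) that(1) \<open>s \<in> L\<close> that(2)] by auto
  moreover have "\<not> prefix (s @ [c]) s" for c by (auto dest: prefix_length_le)
  moreover have "\<not> prefix (s @ [c]) w" if "w \<in> I" for w c
    using calculation(1)[OF that] by (auto dest: append_prefixD)
  ultimately show ?case using tree_grow unfolding grow_def by auto
qed auto

lemma tree_corner_in_nodes:
  assumes "tree I L" "u \<in> L \<union> I" shows "corner_node u i \<in> tree_nodes I"
  using assms
proof (induction arbitrary: u i rule: tree.induct)
  case (tree_grow I L s)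
  then show ?case unfolding grow_def tree_nodes_def by (auto split: if_splits) blast+
qed (auto simp: tree_nodes_def)

lemma tree_card: "tree I L \<Longrightarrow> card L = 2 * card I + 1"
proof (induction rule: tree.induct)
  case (tree_grow I L s)
  have "card (range (\<lambda>c. s @ [c])) = 3"
    using card_corner by (subst card_image) (auto simp: inj_on_def)
  moreover have "(L - {s}) \<inter> range (\<lambda>c. s @ [c]) = {}"
  proof -
    have "s @ [c] \<notin> L" for c
      using tree_prefix_free[OF tree_grow.hyps(1) _ \<open>s \<in> L\<close>, of "s @ [c]"] by (auto simp: parallel_def)
    then show ?thesis by auto
  qed
  moreover have "s \<notin> I" using tree_leaf_not_prefix_of_internal[OF tree_grow.hyps] by blast
  ultimately show ?case
    using tree_grow tree_finite[OF tree_grow.hyps(1)] card_Suc_Diff1[of L s] unfolding grow_def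
    by (subst card_Un_disjoint) auto
qed auto

text \<open>
  A corner of a leaf survives in two of its three children. This lets sums over internal nodes be
  bounded by sums over corners of leaves.
\<close>

lemma tree_internal_is_corner:
  assumes "tree I L" "w \<in> I" shows "\<exists>u \<in> L. \<exists>i. corner_node u i = Inner w"
  using assms
proof (induction arbitrary: w rule: tree.induct)
  case (tree_grow I L s)
  show ?case
  proof (cases "w = s")
    case True
    then show ?thesis by (auto simp: grow_def intro!: bexI[of _ "s @ [C0]"] exI[of _ C0])
  next
    case False
    then obtain u i where ui: "u \<in> L" "corner_node u i = Inner w" using tree_grow.IH tree_grow.prems by blast
    show ?thesis
    proof (cases "u = s")
      case True
      obtain c where "c \<noteq> i" by (metis corner.distinct(1))
      then show ?thesis using ui True
        by (intro bexI[of _ "s @ [c]"] exI[of _ i]) (auto simp: grow_def)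
    qed (use ui in \<open>auto simp: grow_def\<close>)
  qed
qed auto

section \<open>Distances\<close>

definition min3 :: "(corner \<Rightarrow> nat) \<Rightarrow> nat" where
  "min3 d = min (d C0) (min (d C1) (d C2))"

definition dstep :: "(corner \<Rightarrow> nat) \<Rightarrow> corner \<Rightarrow> (corner \<Rightarrow> nat)" where
  "dstep d c = d(c := Suc (min3 d))"

text \<open>
  The distances of the corners of a face to the corners of its ancestor, as a function of the word
  that leads from the ancestor to the face.
\<close>

definition delta :: "corner list \<Rightarrow> (corner \<Rightarrow> nat)" where
  "delta u = foldl dstep (\<lambda>_. 0) u"

lemma delta_simps [simp]: "delta [] = (\<lambda>_. 0)" "delta (u @ [c]) = dstep (delta u) c"
  by (simp_all add: delta_def)

text \<open>
  The corners of a face are adjacent, so their distances to any set differ by at most one.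
\<close>

definition tight :: "(corner \<Rightarrow> nat) \<Rightarrow> bool" where
  "tight d \<longleftrightarrow> (\<forall>i. d i \<le> Suc (min3 d))"

lemma tight_dstep: "tight d \<Longrightarrow> tight (dstep d c)"
  by (cases c) (auto simp: tight_def dstep_def min3_def all_corner)

lemma tight_delta: "tight (delta u)"
  by (induction u rule: rev_induct) (auto simp: tight_dstep, auto simp: tight_def min3_def)

lemma min3_le: "min3 d \<le> d i"
  by (cases i) (auto simp: min3_def)

lemma min3_attained: "\<exists>i. d i = min3 d"
  by (auto simp: min3_def min_def)

lemma relpow_symmetric:
  assumes "sym R" "(a, b) \<in> R ^^ n" shows "(b, a) \<in> R ^^ n"
  using assms(2)
proof (induction n arbitrary: b)
  case (Suc n)
  then obtain y where "(a, y) \<in> R ^^ n" "(y, b) \<in> R" by auto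
  then show ?case using Suc.IH[of y] symD[OF assms(1)] relpow_Suc_I2 by metis
qed auto

lemma relpow_trans: "(a, b) \<in> R ^^ m \<Longrightarrow> (b, c) \<in> R ^^ n \<Longrightarrow> (a, c) \<in> R ^^ (m + n)"
  by (auto simp: relpow_add)

lemma sym_tree_adj: "sym (tree_adj I)"
  unfolding tree_adj_def sym_def by blast

lemma tree_internal_prefix_closed:
  assumes "tree I L" "w \<in> I \<union> L" "strict_prefix p w" shows "p \<in> I"
  using assms
proof (induction arbitrary: w rule: tree.induct)
  case (tree_grow I L s)
  consider "w \<in> I \<union> L" | c where "w = s @ [c]" using tree_grow.prems \<open>s \<in> L\<close> unfolding grow_def by auto
  then show ?case
  proof cases
    case 1
    then show ?thesis using tree_grow by blast
  next
    case 2
    then have "p = s \<or> strict_prefix p s" using tree_grow.prems(2) by (auto simp: strict_prefix_def)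
    then show ?thesis using tree_grow.IH[of s] \<open>s \<in> L\<close> by blast
  qed
qed auto

text \<open>
  From a corner of the face \<open>q @ w\<close> one walks greedily towards the corners of \<open>q\<close>, from each inserted
  node to a corner of its face with minimal value.
\<close>

lemma corner_to_base:
  assumes "tree I L" "v \<in> I \<union> L" "v = q @ w"
  shows "\<exists>i. \<exists>n \<le> delta w k. (corner_node v k, corner_node q i) \<in> tree_adj I ^^ n"
  using assms(2,3)
proof (induction w arbitrary: v k rule: rev_induct)
  case Nil
  then show ?case by (intro exI[of _ k] exI[of _ 0]) auto
next
  case (snoc c w)
  have v: "v = (q @ w) @ [c]" using snoc.prems by simp
  then have "strict_prefix (q @ w) v" by (simp add: strict_prefix_def)
  then have I: "q @ w \<in> I" using tree_internal_prefix_closed[OF assms(1) snoc.prems(1)] by blast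
  show ?case
  proof (cases "k = c")
    case False
    then have "corner_node v k = corner_node (q @ w) k" "delta (w @ [c]) k = delta w k"
      by (simp_all add: v dstep_def del: append_assoc)
    then show ?thesis using snoc.IH[of "q @ w" k] I by auto
  next
    case True
    obtain j where j: "delta w j = min3 (delta w)" using min3_attained by blast
    obtain i n where n: "n \<le> delta w j" "(corner_node (q @ w) j, corner_node q i) \<in> tree_adj I ^^ n"
      using snoc.IH[of "q @ w" j] I by auto
    have "(Inner (q @ w), corner_node (q @ w) j) \<in> tree_adj I" using I unfolding tree_adj_def by blast
    then have "(Inner (q @ w), corner_node q i) \<in> tree_adj I ^^ Suc n" using n(2) by (rule relpow_Suc_I2)
    then show ?thesis using n(1) j True unfolding v corner_node_simps
      by (intro exI[of _ i] exI[of _ "Suc n"]) (auto simp: dstep_def)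
  qed
qed

lemma corners_adjacent:
  assumes "tree I L" "v \<in> I \<union> L" "i \<noteq> j"
  shows "(corner_node v i, corner_node v j) \<in> tree_adj I"
  using assms(2,3)
proof (induction v arbitrary: i j rule: rev_induct)
  case Nil
  then show ?case by (auto simp: tree_adj_def)
next
  case (snoc c v)
  then have "v \<in> I" using tree_internal_prefix_closed[OF assms(1), of "v @ [c]" v] by (simp add: strict_prefix_def)
  then show ?case using snoc.IH[of i j] snoc.prems by (auto simp: tree_adj_def)
qed

text \<open>
  Both children of \<open>p\<close> have their corners among the corners of \<open>p\<close> and the node \<open>Inner p\<close>, which are
  pairwise adjacent; this is the summand 1.
\<close>

lemma distance_upper:
  assumes T: "tree I L" and u: "p @ i # u \<in> L" and v: "p @ j # v \<in> L"
  shows "\<exists>n \<le> delta u k + delta v l + 1. (corner_node (p @ i # u) k, corner_node (p @ j # v) l) \<in> tree_adj I ^^ n"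
proof -
  have p: "p \<in> I" using tree_internal_prefix_closed[OF T, of "p @ i # u" p] u by (simp add: strict_prefix_def)
  obtain a m where m: "m \<le> delta u k" "(corner_node (p @ i # u) k, corner_node (p @ [i]) a) \<in> tree_adj I ^^ m"
    using corner_to_base[OF T UnI2[OF u], of "p @ [i]" u k] unfolding append_Cons append_Nil append_assoc by blast
  obtain b n where n: "n \<le> delta v l" "(corner_node (p @ j # v) l, corner_node (p @ [j]) b) \<in> tree_adj I ^^ n"
    using corner_to_base[OF T UnI2[OF v], of "p @ [j]" v l] unfolding append_Cons append_Nil append_assoc by blast
  have n': "(corner_node (p @ [j]) b, corner_node (p @ j # v) l) \<in> tree_adj I ^^ n"
    using relpow_symmetric[OF sym_tree_adj n(2)] .
  have "corner_node (p @ [i]) a = corner_node (p @ [j]) b \<or> (corner_node (p @ [i]) a, corner_node (p @ [j]) b) \<in> tree_adj I"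
  proof -
    have "(corner_node p a, corner_node p b) \<in> tree_adj I" if "a \<noteq> b"
      using corners_adjacent[OF T _ that] p by blast
    moreover have "(Inner p, corner_node p b) \<in> tree_adj I" "(corner_node p a, Inner p) \<in> tree_adj I"
      using p unfolding tree_adj_def by blast+
    ultimately show ?thesis by (cases "a = b") auto
  qed
  then obtain e where e: "e \<le> 1" "(corner_node (p @ [i]) a, corner_node (p @ [j]) b) \<in> tree_adj I ^^ e"
  proof
    assume "corner_node (p @ [i]) a = corner_node (p @ [j]) b"
    then show thesis using that[of 0] by simp
  next
    assume "(corner_node (p @ [i]) a, corner_node (p @ [j]) b) \<in> tree_adj I"
    then show thesis using that[of 1] by simp
  qed
  show ?thesis
    using relpow_trans[OF relpow_trans[OF m(2) e(2)] n'] m(1) n(1) e(1)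
    by (intro exI[of _ "m + e + n"]) auto
qed

text \<open>
  The distance to the corners of \<open>q\<close> for nodes inserted below \<open>q\<close>, and 0 for all others.
\<close>

definition height_below :: "corner list \<Rightarrow> node \<Rightarrow> nat" where
  "height_below q x = (case x of Outer i \<Rightarrow> 0 | Inner w \<Rightarrow>
     if prefix q w then Suc (min3 (delta (drop (length q) w))) else 0)"

lemma height_below_corner:
  "height_below q (corner_node v k) = (if prefix q v then delta (drop (length q) v) k else 0)"
proof (induction v arbitrary: k rule: rev_induct)
  case (snoc c v)
  show ?case
  proof (cases "prefix q v")
    case True
    then have "drop (length q) (v @ [c]) = drop (length q) v @ [c]" by (auto dest: prefix_length_le)
    then show ?thesis using True snoc by (auto simp: height_below_def dstep_def)
  next
    case False
    then have "prefix q (v @ [c]) \<Longrightarrow> q = v @ [c]" by (auto simp: prefix_snoc)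
    then show ?thesis using False snoc by (auto simp: height_below_def)
  qed
qed (auto simp: height_below_def)

lemma height_below_adj:
  assumes "(x, y) \<in> tree_adj I" shows "height_below q x \<le> Suc (height_below q y)"
proof -
  have *: "height_below q (Inner w) \<le> Suc (height_below q (corner_node w i))"
    "height_below q (corner_node w i) \<le> Suc (height_below q (Inner w))" for w i
    unfolding height_below_corner
    using min3_le[of "delta (drop (length q) w)" i] tight_delta[of "drop (length q) w"]
    by (auto simp: height_below_def tight_def intro: le_SucI)
  show ?thesis using assms unfolding tree_adj_def
    by (auto simp: height_below_def[of _ "Outer _"] *)
qed

text \<open>
  For incomparable \<open>q\<close> and \<open>r\<close> this is positive below \<open>q\<close>, negative below \<open>r\<close> and 0 elsewhere. It changes
  by at most one along an edge, since no edge leads from below \<open>q\<close> to below \<open>r\<close>.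
\<close>

definition height_diff :: "corner list \<Rightarrow> corner list \<Rightarrow> node \<Rightarrow> int" where
  "height_diff q r x = int (height_below q x) - int (height_below r x)"

lemma height_diff_adj:
  assumes "q \<parallel> r" "(x, y) \<in> tree_adj I" shows "height_diff q r x \<le> height_diff q r y + 1"
proof -
  have z: "height_below q (Inner w) = 0 \<and> height_below q (corner_node w i) = 0 \<or>
    height_below r (Inner w) = 0 \<and> height_below r (corner_node w i) = 0" for w i
    unfolding height_below_corner using assms(1) 
    by (auto simp: height_below_def dest: prefix_same_cases)
  have "height_below q x \<le> Suc (height_below q y)" "height_below r y \<le> Suc (height_below r x)"
    using height_below_adj assms(2) symD[OF sym_tree_adj] by blast+
  moreover have "height_below q x = 0 \<and> height_below q y = 0 \<or> height_below r x = 0 \<and> height_below r y = 0"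
  proof -
    consider i j where "x = Outer i" "y = Outer j" | w i where "x = Inner w" "y = corner_node w i"
      | w i where "y = Inner w" "x = corner_node w i"
      using assms(2) unfolding tree_adj_def by auto
    then show ?thesis
    proof cases
      case 1
      then show ?thesis by (simp add: height_below_def)
    next
      case (2 w i)
      then show ?thesis using z[of w i] by simp
    next
      case (3 w i)
      then show ?thesis using z[of w i] by auto
    qed
  qed
  ultimately show ?thesis unfolding height_diff_def by auto
qed

lemma height_diff_relpow:
  assumes "q \<parallel> r" "(x, y) \<in> tree_adj I ^^ n" shows "height_diff q r x \<le> height_diff q r y + int n"
  using assms(2)
proof (induction n arbitrary: y)
  case (Suc n)
  then obtain z where "(x, z) \<in> tree_adj I ^^ n" "(z, y) \<in> tree_adj I" by auto
  then show ?case using Suc.IH[of z] height_diff_adj[OF assms(1), of z y I] by simp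
qed auto

lemma distance_lower:
  assumes "(corner_node (p @ i # u) k, corner_node (p @ j # v) l) \<in> tree_adj I ^^ n" "i \<noteq> j"
  shows "delta u k + delta v l \<le> n"
proof -
  have "(p @ [i]) \<parallel> (p @ [j])" using assms(2) by (simp add: parallel_def)
  from height_diff_relpow[OF this assms(1)] show ?thesis
    using assms(2) by (simp add: height_diff_def height_below_corner)
qed

section \<open>A multiplicative weight on pairs of faces\<close>

text \<open>
  The factor carried by one unit of distance. It is the value for which \<open>t\<close> is an eigenvalue of the
  chain of shapes: a shape with \<open>n\<close> corners off the minimum has \<open>n\<close> children with the same \<open>n\<close> and
  \<open>3 - n\<close> children with \<open>n + 1\<close>, where \<open>n = 3\<close> means \<open>n = 0\<close> one unit higher. The eigenvalue equation is
  \<open>t (t - 1) (t - 2) = 6 z\<close>.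
\<close>

definition zval :: "real \<Rightarrow> real" where
  "zval t = t * (t - 1) * (t - 2) / 6"

text \<open>
  The eigenvector, indexed by the number of corners off the minimum.
\<close>

definition shape_weight :: "real \<Rightarrow> nat \<Rightarrow> real" where
  "shape_weight t n = (if n = 0 then 1 else if n = 1 then t / 3 else t * (t - 1) / 6)"

definition weight :: "real \<Rightarrow> (corner \<Rightarrow> nat) \<Rightarrow> real" where
  "weight t d = shape_weight t (d C0 + d C1 + d C2 - 3 * min3 d) * zval t ^ min3 d"

lemma weight_dstep:
  assumes "tight d" shows "(\<Sum>c\<in>UNIV. weight t (dstep d c)) = t * weight t d"
proof -
  define m where "m = min3 d"
  have d: "m \<le> d i" "d i \<le> Suc m" for i
    using min3_le assms unfolding m_def tight_def by blast+
  have att: "d C0 = m \<or> d C1 = m \<or> d C2 = m" unfolding m_def min3_def by (auto simp: min_def)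
  have c: "d i = m \<or> d i = Suc m" for i using d[of i] by linarith
  \<comment> \<open>All distances occurring here are \<open>m\<close> or \<open>m + 1\<close>; relative to \<open>m\<close>, three corners off the minimum
    amount to one more unit of height.\<close>
  have w: "weight t e = (let n = (e C0 - m) + (e C1 - m) + (e C2 - m)
      in (if n = 3 then zval t else shape_weight t n) * zval t ^ m)" if e: "\<And>i. e i = m \<or> e i = Suc m" for e
    using e[of C0] e[of C1] e[of C2]
    by (elim disjE) (simp_all add: weight_def min3_def shape_weight_def)
  have mm: "min3 d = m" by (simp add: m_def)
  have wd: "weight t d = (let n = (d C0 - m) + (d C1 - m) + (d C2 - m)
      in (if n = 3 then zval t else shape_weight t n) * zval t ^ m)"
    by (rule w[OF c])
  have ws: "weight t (dstep d k) = (let n = (dstep d k C0 - m) + (dstep d k C1 - m) + (dstep d k C2 - m)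
      in (if n = 3 then zval t else shape_weight t n) * zval t ^ m)" for k
    by (rule w) (use c mm in \<open>auto simp: dstep_def\<close>)
  define Z where "Z = zval t ^ m"
  have z: "zval t = t * (t - 1) * (t - 2) / 6" by (simp add: zval_def)
  have "(\<Sum>c\<in>UNIV. weight t (dstep d c)) - t * weight t d = 0"
    unfolding sum_corner wd ws Z_def[symmetric]
    using c[of C0] c[of C1] c[of C2] att
    by (elim disjE) (simp_all add: dstep_def mm shape_weight_def z, simp_all add: field_simps)
  then show ?thesis by simp
qed

text \<open>
  The common prefix of the two addresses is dropped: distances are measured from the corners of the
  two children in which the faces separate. Comparable words get weight 0; in particular the diagonal
  does not contribute to sums over pairs of leaves.
\<close>

fun pair_weight :: "real \<Rightarrow> corner list \<Rightarrow> corner list \<Rightarrow> real" where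
  "pair_weight t (i # u) (j # v) =
     (if i = j then pair_weight t u v else weight t (delta u) * weight t (delta v))"
| "pair_weight t _ _ = 0"

lemma pair_weight_sym: "pair_weight t u v = pair_weight t v u"
  by (induction t u v rule: pair_weight.induct) auto

lemma pair_weight_branch [simp]:
  "i \<noteq> j \<Longrightarrow> pair_weight t (p @ i # u) (p @ j # v) = weight t (delta u) * weight t (delta v)"
  by (induction p) auto

lemma pair_weight_prefix [simp]: "pair_weight t u (u @ v) = 0" "pair_weight t (u @ v) u = 0" "pair_weight t u u = 0"
proof -
  show 1: "pair_weight t u (u @ v) = 0" for v by (induction u) auto
  then show "pair_weight t (u @ v) u = 0" by (simp add: pair_weight_sym)
  show "pair_weight t u u = 0" using 1[of "[]"] by simp
qed

lemma weight_zero: "weight t (\<lambda>_. 0) = 1"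
  by (simp add: weight_def min3_def shape_weight_def)

lemma pair_weight_siblings: "pair_weight t (s @ [c]) (s @ [c']) = (if c = c' then 0 else 1)"
  by (auto simp: weight_zero)

lemma pair_weight_extend:
  assumes "u \<parallel> v" shows "(\<Sum>c\<in>UNIV. pair_weight t (u @ [c]) v) = t * pair_weight t u v"
proof -
  obtain p i u' j v' where *: "i \<noteq> j" "u = p @ i # u'" "v = p @ j # v'"
    using parallel_decomp[OF assms] by blast
  have "(\<Sum>c\<in>UNIV. pair_weight t (u @ [c]) v) = (\<Sum>c\<in>UNIV. weight t (delta (u' @ [c]))) * weight t (delta v')"
    unfolding * using *(1) by (simp add: sum_distrib_right)
  also have "\<dots> = t * pair_weight t u v"
    using *(1) unfolding * delta_simps weight_dstep[OF tight_delta] by simp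
  finally show ?thesis .
qed

definition pair_sum :: "real \<Rightarrow> corner list set \<Rightarrow> real" where
  "pair_sum t L = (\<Sum>u\<in>L. \<Sum>v\<in>L. pair_weight t u v)"

lemma sum_grow:
  fixes f :: "corner list \<Rightarrow> real"
  assumes "tree I L" "s \<in> L"
  shows "sum f (grow L s) = sum f L - f s + (\<Sum>c\<in>UNIV. f (s @ [c]))"
proof -
  have n: "s @ [c] \<notin> L" for c
    using tree_prefix_free[OF assms(1) _ assms(2), of "s @ [c]"] by (auto simp: parallel_def)
  have "sum f (grow L s) = sum f (L - {s}) + sum f (range (\<lambda>c. s @ [c]))"
    unfolding grow_def using tree_finite[OF assms(1)] n by (intro sum.union_disjoint) auto
  also have "sum f (L - {s}) = sum f L - f s"
    using tree_finite[OF assms(1)] assms(2) by (simp add: sum_diff1)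
  also have "sum f (range (\<lambda>c. s @ [c])) = (\<Sum>c\<in>UNIV. f (s @ [c]))"
    by (subst sum.reindex) (auto simp: inj_on_def)
  finally show ?thesis .
qed

text \<open>
  The pairs of a child of \<open>s\<close> with an old leaf carry \<open>t\<close> times the weight that \<open>s\<close> had, in both orders;
  the six pairs of distinct children have weight 1.
\<close>

lemma pair_sum_grow:
  assumes T: "tree I L" and s: "s \<in> L"
  shows "pair_sum t (grow L s) = pair_sum t L + 2 * (t - 1) * (\<Sum>v\<in>L. pair_weight t s v) + 6"
proof -
  define R where "R u = (\<Sum>v\<in>L. pair_weight t u v)" for u
  \<comment> \<open>For \<open>v = s\<close> both sides vanish, so the diagonal needs no exception in the sums.\<close>
  have ext: "(\<Sum>c\<in>UNIV. pair_weight t (s @ [c]) v) = t * pair_weight t s v" if "v \<in> L" for v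
  proof (cases "v = s")
    case False
    then show ?thesis using pair_weight_extend tree_prefix_free[OF T s that] by blast
  qed simp
  have A: "(\<Sum>v\<in>grow L s. pair_weight t u v) = R u + (t - 1) * pair_weight t s u" if "u \<in> L" for u
    using ext[OF that] by (simp add: sum_grow[OF T s] R_def pair_weight_sym[of t u] algebra_simps)
  have B: "(\<Sum>v\<in>grow L s. pair_weight t (s @ [c]) v) = R (s @ [c]) + 2" for c
    by (cases c) (simp_all add: sum_grow[OF T s] R_def pair_weight_siblings sum_corner)
  have "(\<Sum>c\<in>UNIV. R (s @ [c])) = (\<Sum>v\<in>L. \<Sum>c\<in>UNIV. pair_weight t (s @ [c]) v)"
    unfolding R_def by (rule sum.swap)
  also have "\<dots> = t * R s" using ext by (simp add: R_def sum_distrib_left)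
  finally have C: "(\<Sum>c\<in>UNIV. R (s @ [c])) = t * R s" .
  have "pair_sum t (grow L s) = (\<Sum>u\<in>L. \<Sum>v\<in>grow L s. pair_weight t u v)
      - (\<Sum>v\<in>grow L s. pair_weight t s v) + (\<Sum>c\<in>UNIV. \<Sum>v\<in>grow L s. pair_weight t (s @ [c]) v)"
    unfolding pair_sum_def by (rule sum_grow[OF T s])
  also have "(\<Sum>u\<in>L. \<Sum>v\<in>grow L s. pair_weight t u v) = pair_sum t L + (t - 1) * R s"
    using A by (simp add: sum.distrib pair_sum_def R_def sum_distrib_left)
  also have "(\<Sum>v\<in>grow L s. pair_weight t s v) = R s" using A[OF s] by simp
  also have "(\<Sum>c\<in>UNIV. \<Sum>v\<in>grow L s. pair_weight t (s @ [c]) v) = t * R s + 6"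
    unfolding B using C by (simp add: sum.distrib card_corner)
  finally show ?thesis by (simp add: R_def algebra_simps)
qed

text \<open>
  The six new pairs of siblings make the recursion of \<open>pair_sum\<close> inhomogeneous. The multiple of the
  number of leaves is chosen to absorb this term, which turns the recursion into an exact product.
\<close>

definition potential :: "real \<Rightarrow> corner list set \<Rightarrow> real" where
  "potential t L = pair_sum t L + 3 / (t - 2) * real (card L)"

lemma card_grow:
  assumes "tree I L" "s \<in> L" shows "card (grow L s) = card L + 2"
proof -
  have "real (card (grow L s)) = real (card L) + 2"
    using sum_grow[OF assms, of "\<lambda>_. 1"] by (simp add: card_corner)
  then show ?thesis by linarith
qed

text \<open>
  Divided by the number of leaves this is the conditional mean of the potential after one step.
\<close>

lemma sum_potential_grow:
  assumes T: "tree I L" and "t \<noteq> 2"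
  shows "(\<Sum>s\<in>L. potential t (grow L s)) = (real (card L) + 2 * (t - 1)) * potential t L"
proof -
  let ?F = "real (card L)"
  have "(\<Sum>s\<in>L. potential t (grow L s)) =
      (\<Sum>s\<in>L. pair_sum t L + 6 + 3 / (t - 2) * (?F + 2) + 2 * (t - 1) * (\<Sum>v\<in>L. pair_weight t s v))"
    by (rule sum.cong) (auto simp: potential_def pair_sum_grow[OF T] card_grow[OF T] algebra_simps)
  also have "\<dots> = ?F * (pair_sum t L + 6 + 3 / (t - 2) * (?F + 2)) + 2 * (t - 1) * pair_sum t L"
  proof -
    have "(\<Sum>s\<in>L. K + 2 * (t - 1) * r s) = ?F * K + 2 * (t - 1) * sum r L" for K r
      by (simp add: sum.distrib sum_distrib_left)
    then show ?thesis unfolding pair_sum_def .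
  qed
  also have "\<dots> = (?F + 2 * (t - 1)) * potential t L"
    unfolding potential_def using assms(2) by (simp add: field_simps)
  finally show ?thesis .
qed

section \<open>Growth of the expected potential\<close>

text \<open>
  The law of the set of leaves after \<open>k\<close> insertions; it corresponds to \<open>stack_law (Suc k)\<close>.
\<close>

primrec leaf_law :: "nat \<Rightarrow> corner list set pmf" where
  "leaf_law 0 = return_pmf {[]}"
| "leaf_law (Suc k) = bind_pmf (leaf_law k) (\<lambda>L. map_pmf (grow L) (pmf_of_set L))"

lemma leaf_law_support:
  assumes "L \<in> set_pmf (leaf_law k)" shows "\<exists>I. tree I L \<and> card L = 2 * k + 1"
  using assms
proof (induction k arbitrary: L)
  case 0
  then show ?case by (auto intro: tree_root)
next
  case (Suc k)
  then obtain L0 where L0: "L0 \<in> set_pmf (leaf_law k)" "L \<in> grow L0 ` set_pmf (pmf_of_set L0)" by auto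
  then obtain I where I: "tree I L0" "card L0 = 2 * k + 1" using Suc.IH by blast
  then have "L0 \<noteq> {}" by auto
  then obtain s where "s \<in> L0" "L = grow L0 s"
    using L0 tree_finite[OF I(1)] by auto
  then show ?case using I tree_grow card_grow by fastforce
qed

lemma finite_leaf_law: "finite (set_pmf (leaf_law k))"
proof (induction k)
  case (Suc k)
  have "finite (set_pmf (pmf_of_set L))" if "L \<in> set_pmf (leaf_law k)" for L
    using leaf_law_support[OF that] tree_finite by (subst set_pmf_of_set) fastforce+
  then show ?case using Suc by auto
qed simp

lemma expectation_potential:
  assumes "t \<noteq> 2"
  shows "measure_pmf.expectation (leaf_law k) (potential t) = 3 / (t - 2) * (\<Prod>j<k. 1 + 2 * (t - 1) / (2 * real j + 1))"
proof (induction k)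
  case 0
  then show ?case by (simp add: potential_def pair_sum_def)
next
  case (Suc k)
  have step: "measure_pmf.expectation (map_pmf (grow L) (pmf_of_set L)) (potential t) =
      (1 + 2 * (t - 1) / (2 * real k + 1)) * potential t L" if L: "L \<in> set_pmf (leaf_law k)" for L
  proof -
    obtain I where I: "tree I L" "card L = 2 * k + 1" using leaf_law_support[OF L] by blast
    then have "measure_pmf.expectation (map_pmf (grow L) (pmf_of_set L)) (potential t) =
       (\<Sum>s\<in>L. potential t (grow L s)) / (2 * real k + 1)"
      using tree_finite[OF I(1)] by (subst integral_map_pmf, subst integral_pmf_of_set) auto
    also have "\<dots> = (2 * real k + 1 + 2 * (t - 1)) * potential t L / (2 * real k + 1)"
      by (simp add: sum_potential_grow[OF I(1) assms] I(2) algebra_simps)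
    also have "\<dots> = (1 + 2 * (t - 1) / (2 * real k + 1)) * potential t L"
      by (simp add: field_simps)
    finally show ?thesis .
  qed
  have fin: "finite (set_pmf (map_pmf (grow L) (pmf_of_set L)))" if "L \<in> set_pmf (leaf_law k)" for L
    using finite_leaf_law[of "Suc k"] that by (auto intro: finite_subset[rotated])
  have "measure_pmf.expectation (leaf_law (Suc k)) (potential t) =
     (\<Sum>L\<in>set_pmf (leaf_law k). pmf (leaf_law k) L *\<^sub>R measure_pmf.expectation (map_pmf (grow L) (pmf_of_set L)) (potential t))"
    unfolding leaf_law.simps using fin finite_leaf_law by (intro pmf_expectation_bind) auto
  also have "\<dots> = (1 + 2 * (t - 1) / (2 * real k + 1)) * (\<Sum>L\<in>set_pmf (leaf_law k). pmf (leaf_law k) L * potential t L)"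
    unfolding sum_distrib_left by (rule sum.cong[OF refl]) (simp only: step real_scaleR_def mult.left_commute)
  also have "(\<Sum>L\<in>set_pmf (leaf_law k). pmf (leaf_law k) L * potential t L) = measure_pmf.expectation (leaf_law k) (potential t)"
    using finite_leaf_law by (subst integral_measure_pmf[of "set_pmf (leaf_law k)"]) auto
  finally show ?case unfolding Suc.IH by simp
qed

text \<open>
  Only the leading coefficient 1/2 of the logarithm matters: it fixes the exponent in
  \<open>expectation_potential_le\<close>.
\<close>

lemma sum_odd_reciprocals_le:
  assumes "k > 0" shows "(\<Sum>j<k. 1 / (2 * real j + 1)) \<le> 3 / 2 + ln (real k) / 2"
proof -
  have "(\<Sum>j<k. 1 / (2 * real j + 1)) \<le> 1 + harm k / 2"
  proof -
    have "(\<Sum>j<Suc m. 1 / (2 * real j + 1)) \<le> 1 + harm m / 2" for m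
    proof (induction m)
      case (Suc m)
      have "1 / (2 * real (Suc m) + 1) \<le> 1 / (2 * real (Suc m))" by (intro divide_left_mono) auto
      also have "\<dots> = inverse (real (Suc m)) / 2" by (simp add: field_simps)
      finally have "1 / (2 * real (Suc m) + 1) \<le> inverse (real (Suc m)) / 2" .
      moreover have "(\<Sum>j<Suc (Suc m). 1 / (2 * real j + 1)) = (\<Sum>j<Suc m. 1 / (2 * real j + 1)) + 1 / (2 * real (Suc m) + 1)"
        by (rule sum.lessThan_Suc)
      moreover have "harm (Suc m) = harm m + inverse (real (Suc m))" by (simp add: harm_Suc)
      ultimately show ?case using Suc by linarith
    qed (simp add: harm_expand)
    from this[of "k - 1"] have "(\<Sum>j<k. 1 / (2 * real j + 1)) \<le> 1 + harm (k - 1) / 2"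
      using assms by simp
    also have "\<dots> \<le> 1 + harm k / 2" by (simp add: harm_mono)
    finally show ?thesis .
  qed
  then show ?thesis using euler_mascheroni_sequence_decreasing[of 1 k] assms by (simp add: harm_Suc harm_expand(1))
qed

lemma expectation_potential_le:
  assumes "t > 2" "k > 0"
  shows "measure_pmf.expectation (leaf_law k) (potential t) \<le> 3 / (t - 2) * exp (3 * (t - 1)) * real k powr (t - 1)"
proof -
  have "(\<Prod>j<k. 1 + 2 * (t - 1) / (2 * real j + 1)) \<le> (\<Prod>j<k. exp (2 * (t - 1) / (2 * real j + 1)))"
    using assms by (intro prod_mono) (auto simp: add_nonneg_nonneg)
  also have "\<dots> = exp (2 * (t - 1) * (\<Sum>j<k. 1 / (2 * real j + 1)))"
    by (simp add: exp_sum sum_distrib_left)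
  also have "\<dots> \<le> exp (2 * (t - 1) * (3 / 2 + ln (real k) / 2))"
    using sum_odd_reciprocals_le[OF assms(2)] assms(1) by (auto intro!: mult_left_mono)
  also have "\<dots> = exp (3 * (t - 1)) * real k powr (t - 1)"
    using assms(2) by (simp add: powr_def exp_add[symmetric] algebra_simps add_divide_distrib)
  finally show ?thesis
    unfolding expectation_potential[OF less_imp_neq[OF assms(1), symmetric]]
    using assms(1) by (simp add: mult_left_mono divide_right_mono)
qed

section \<open>Exponential moments of distances\<close>

definition tree_dist :: "corner list set \<Rightarrow> node \<Rightarrow> node \<Rightarrow> nat" where
  "tree_dist I x y = (LEAST n. (x, y) \<in> tree_adj I ^^ n)"

text \<open>
  The distance of two faces is determined up to 3 by the minima of their heights over the node where
  they separate: 1 for crossing between the two children of that node and 1 for each of the two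
  corners that need not attain the minimum.
\<close>

lemma tree_dist_pair:
  assumes T: "tree I L" and uv: "u \<in> L" "v \<in> L" "u \<noteq> v"
  obtains p i j u' v' where "i \<noteq> j" "u = p @ i # u'" "v = p @ j # v'"
    "\<And>k l. min3 (delta u') + min3 (delta v') \<le> tree_dist I (corner_node u k) (corner_node v l)"
    "\<And>k l. tree_dist I (corner_node u k) (corner_node v l) \<le> min3 (delta u') + min3 (delta v') + 3"
proof -
  obtain p i u' j v' where *: "i \<noteq> j" "u = p @ i # u'" "v = p @ j # v'"
    using parallel_decomp[OF tree_prefix_free[OF T uv]] by blast
  have up: "\<exists>n \<le> delta u' k + delta v' l + 1. (corner_node u k, corner_node v l) \<in> tree_adj I ^^ n" for k l
    using distance_upper[OF T] uv unfolding * by blast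
  show thesis
  proof (rule that[OF *])
    fix k l
    obtain n where n: "n \<le> delta u' k + delta v' l + 1" "(corner_node u k, corner_node v l) \<in> tree_adj I ^^ n"
      using up by blast
    have "(corner_node u k, corner_node v l) \<in> tree_adj I ^^ tree_dist I (corner_node u k) (corner_node v l)"
      unfolding tree_dist_def by (rule LeastI) (rule n(2))
    then have "delta u' k + delta v' l \<le> tree_dist I (corner_node u k) (corner_node v l)"
      using distance_lower *(1) unfolding *(2,3) by blast
    then show "min3 (delta u') + min3 (delta v') \<le> tree_dist I (corner_node u k) (corner_node v l)"
      using min3_le[of "delta u'" k] min3_le[of "delta v'" l] by linarith
    have "tree_dist I (corner_node u k) (corner_node v l) \<le> n"
      unfolding tree_dist_def by (rule Least_le) (rule n(2))
    moreover have "delta u' k \<le> Suc (min3 (delta u'))" "delta v' l \<le> Suc (min3 (delta v'))"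
      using tight_delta unfolding tight_def by blast+
    ultimately show "tree_dist I (corner_node u k) (corner_node v l) \<le> min3 (delta u') + min3 (delta v') + 3"
      using n(1) by linarith
  qed
qed

lemma tree_dist_same_face:
  assumes T: "tree I L" and u: "u \<in> L"
  shows "tree_dist I (corner_node u k) (corner_node u l) \<le> 1"
proof (cases "k = l")
  case True
  then have "tree_dist I (corner_node u k) (corner_node u l) = 0"
    unfolding tree_dist_def by (intro Least_equality) auto
  then show ?thesis by simp
next
  case False
  then have "(corner_node u k, corner_node u l) \<in> tree_adj I ^^ 1"
    using corners_adjacent[OF T, of u k l] u by simp
  then show ?thesis unfolding tree_dist_def by (rule Least_le)
qed

lemma power_sandwich:
  fixes z :: real
  assumes "z > 0" "m \<le> n" "n \<le> m + r" shows "z ^ n \<le> max 1 z ^ r * z ^ m"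
proof -
  have "z ^ (n - m) \<le> max 1 z ^ (n - m)" using assms by (intro power_mono) auto
  also have "\<dots> \<le> max 1 z ^ r" using assms by (intro power_increasing) auto
  finally have "z ^ (n - m) * z ^ m \<le> max 1 z ^ r * z ^ m" using assms by (intro mult_right_mono) auto
  then show ?thesis using assms by (simp flip: power_add)
qed

lemma zval_pos: "t > 2 \<Longrightarrow> zval t > 0"
  by (simp add: zval_def)

definition min_weight :: "real \<Rightarrow> real" where
  "min_weight t = Min {1, t / 3, t * (t - 1) / 6}"

lemma min_weight_pos: "t > 2 \<Longrightarrow> min_weight t > 0"
  by (simp add: min_weight_def)

lemma weight_lower: "t > 2 \<Longrightarrow> min_weight t * zval t ^ min3 d \<le> weight t d"
  unfolding weight_def using zval_pos[of t]
  by (intro mult_right_mono) (auto simp: min_weight_def shape_weight_def)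

lemma weight_nonneg: "t > 2 \<Longrightarrow> weight t d \<ge> 0"
  using weight_lower[of t d] min_weight_pos[of t] zval_pos[of t]
  by (meson less_imp_le mult_nonneg_nonneg order_trans zero_le_power)

lemma pair_weight_nonneg: "t > 2 \<Longrightarrow> pair_weight t u v \<ge> 0"
  by (induction t u v rule: pair_weight.induct) (auto simp: weight_nonneg)

text \<open>
  The first summand serves pairs of distinct faces and the second one pairs of corners of the same
  face; the factor \<open>9\<close> counts pairs of corners.
\<close>

definition moment_const :: "real \<Rightarrow> real" where
  "moment_const t = 9 * max 1 (zval t) ^ 3 / (min_weight t)\<^sup>2 + 9 * max 1 (zval t) * (t - 2) / 3"

lemma sum_internal_le_sum_corners:
  fixes h :: "node \<Rightarrow> real"
  assumes T: "tree I L" and "\<And>x. h x \<ge> 0"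
  shows "(\<Sum>a\<in>I. h (Inner a)) \<le> (\<Sum>u\<in>L. \<Sum>k\<in>UNIV. h (corner_node u k))"
proof -
  have "(\<Sum>a\<in>I. h (Inner a)) = (\<Sum>x\<in>Inner ` I. h x)"
    by (subst sum.reindex) (auto simp: inj_on_def)
  also have "\<dots> \<le> (\<Sum>(u, k)\<in>L \<times> UNIV. h (corner_node u k))"
  proof (rule sum_le_included[where i = "\<lambda>(u, k). corner_node u k"])
    show "\<forall>x\<in>Inner ` I. \<exists>y\<in>L \<times> UNIV. (case y of (u, k) \<Rightarrow> corner_node u k) = x \<and>
        h x \<le> (case y of (u, k) \<Rightarrow> h (corner_node u k))"
      using tree_internal_is_corner[OF T] by fastforce
  qed (use tree_finite[OF T] assms in auto)
  also have "\<dots> = (\<Sum>u\<in>L. \<Sum>k\<in>UNIV. h (corner_node u k))"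
    by (simp add: sum.cartesian_product)
  finally show ?thesis .
qed

text \<open>
  Every pair of nodes is a pair of corners of two leaves, and for corners of distinct leaves
  \<open>tree_dist_pair\<close> compares the power of the distance with the product weight.
\<close>

lemma sum_power_tree_dist_le:
  assumes T: "tree I L" and t: "t > 2"
  shows "(\<Sum>a\<in>I. \<Sum>b\<in>I. zval t ^ tree_dist I (Inner a) (Inner b)) \<le> moment_const t * potential t L"
proof -
  define z where "z = zval t"
  define c where "c = max 1 z ^ 3 / (min_weight t)\<^sup>2"
  have z: "z > 0" using zval_pos[OF t] z_def by simp
  have mw: "min_weight t > 0" using min_weight_pos[OF t] .
  have pt: "z ^ tree_dist I (corner_node u k) (corner_node v l) \<le> c * pair_weight t u v + (if u = v then max 1 z else 0)"
    if uv: "u \<in> L" "v \<in> L" for u v k l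
  proof (cases "u = v")
    case True
    then have "z ^ tree_dist I (corner_node u k) (corner_node v l) \<le> max 1 z ^ 1 * z ^ 0"
      using tree_dist_same_face[OF T uv(1)] by (intro power_sandwich z) auto
    then show ?thesis using True by simp
  next
    case False
    obtain p i j u' v' where *: "i \<noteq> j" "u = p @ i # u'" "v = p @ j # v'"
      "\<And>k l. min3 (delta u') + min3 (delta v') \<le> tree_dist I (corner_node u k) (corner_node v l)"
      "\<And>k l. tree_dist I (corner_node u k) (corner_node v l) \<le> min3 (delta u') + min3 (delta v') + 3"
      using tree_dist_pair[OF T uv False] by metis
    have "z ^ tree_dist I (corner_node u k) (corner_node v l) \<le> max 1 z ^ 3 * z ^ (min3 (delta u') + min3 (delta v'))"
      by (rule power_sandwich[OF z *(4,5)])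
    also have "\<dots> = c * ((min_weight t * z ^ min3 (delta u')) * (min_weight t * z ^ min3 (delta v')))"
      using mw by (simp add: c_def power_add power2_eq_square field_simps)
    also have "\<dots> \<le> c * (weight t (delta u') * weight t (delta v'))"
      using weight_lower[OF t] weight_nonneg[OF t] mw z unfolding z_def[symmetric]
      by (intro mult_left_mono mult_mono) (auto simp: c_def)
    also have "\<dots> = c * pair_weight t u v" using *(1-3) by simp
    finally show ?thesis using False by simp
  qed
  have "(\<Sum>a\<in>I. \<Sum>b\<in>I. z ^ tree_dist I (Inner a) (Inner b))
      \<le> (\<Sum>u\<in>L. \<Sum>k\<in>UNIV. \<Sum>b\<in>I. z ^ tree_dist I (corner_node u k) (Inner b))"
    using z by (intro sum_internal_le_sum_corners[OF T, of "\<lambda>x. \<Sum>b\<in>I. z ^ tree_dist I x (Inner b)"]) (auto intro: sum_nonneg)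
  also have "\<dots> \<le> (\<Sum>u\<in>L. \<Sum>k\<in>(UNIV::corner set). \<Sum>v\<in>L. \<Sum>l\<in>UNIV. z ^ tree_dist I (corner_node u k) (corner_node v l))"
    using z by (intro sum_mono sum_internal_le_sum_corners[OF T]) auto
  also have "\<dots> \<le> (\<Sum>u\<in>L. \<Sum>k\<in>(UNIV::corner set). \<Sum>v\<in>L. \<Sum>l\<in>(UNIV::corner set). c * pair_weight t u v + (if u = v then max 1 z else 0))"
    by (intro sum_mono pt)
  also have "\<dots> = 9 * c * pair_sum t L + 9 * max 1 z * real (card L)"
    using tree_finite[OF T]
    by (simp add: card_corner sum.distrib pair_sum_def sum_distrib_left[symmetric] sum_distrib_right[symmetric] sum.delta algebra_simps)
  also have "\<dots> \<le> moment_const t * potential t L"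
  proof -
    let ?a = "9 * c" and ?b = "9 * max 1 z * (t - 2) / 3"
    have ps: "pair_sum t L \<ge> 0"
    proof -
      show ?thesis unfolding pair_sum_def by (intro sum_nonneg pair_weight_nonneg t)
    qed
    have "c \<ge> 0" unfolding c_def by auto
    have "?b * (3 / (t - 2) * real (card L)) = 9 * max 1 z * real (card L)" using t by (simp add: field_simps)
    moreover have "?a * (3 / (t - 2) * real (card L)) \<ge> 0" "?b * pair_sum t L \<ge> 0"
      using \<open>c \<ge> 0\<close> t ps by auto
    moreover have "moment_const t = ?a + ?b" unfolding moment_const_def c_def z_def by simp
    moreover have "(?a + ?b) * (P + Q) = ?a * P + ?a * Q + (?b * P + ?b * Q)" for P Q
      by (simp only: distrib_left distrib_right add.assoc add.left_commute)
    ultimately show ?thesis unfolding potential_def by (smt (verit))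
  qed
  finally show ?thesis unfolding z_def .
qed

section \<open>Drawings realising a tree\<close>

text \<open>
  The last two clauses single out the three outer nodes; with them the internal vertices of the map
  are the internal nodes of the tree.
\<close>

definition realizes ::
  "emap \<Rightarrow> (node \<Rightarrow> complex) \<Rightarrow> (corner list \<Rightarrow> complex set) \<Rightarrow> corner list set \<Rightarrow> corner list set \<Rightarrow> bool" where
  "realizes m \<phi> F I L \<longleftrightarrow> closed (support m) \<and>
     inj_on \<phi> (tree_nodes I) \<and> verts m = \<phi> ` tree_nodes I \<and> adj m = map_prod \<phi> \<phi> ` tree_adj I \<and>
     bij_betw F L (finite_faces m) \<and>
     (\<forall>u \<in> L. tri_face m (F u) (\<phi> (corner_node u C0)) (\<phi> (corner_node u C1)) (\<phi> (corner_node u C2))) \<and>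
     (\<exists>f \<in> faces m. \<not> bounded f) \<and>
     (\<forall>f \<in> faces m. \<not> bounded f \<longrightarrow> face_verts m f = \<phi> ` range Outer)"

lemma tree_adj_subset:
  assumes "tree I L" shows "tree_adj I \<subseteq> tree_nodes I \<times> tree_nodes I"
proof -
  have "corner_node w i \<in> tree_nodes I" if "w \<in> I" for w i
    using tree_corner_in_nodes[OF assms, of w i] that by blast
  then show ?thesis unfolding tree_adj_def by (auto simp: tree_nodes_def)
qed

lemma relpow_map_prod_inj:
  assumes inj: "inj_on \<phi> V" and sub: "A \<subseteq> V \<times> V" and a: "a \<in> V" and b: "b \<in> V"
  shows "(\<phi> a, \<phi> b) \<in> (map_prod \<phi> \<phi> ` A) ^^ n \<longleftrightarrow> (a, b) \<in> A ^^ n"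
  using b
proof (induction n arbitrary: b)
  case 0
  then show ?case using inj a by (auto simp: inj_on_eq_iff)
next
  case (Suc n)
  show ?case
  proof
    assume "(\<phi> a, \<phi> b) \<in> (map_prod \<phi> \<phi> ` A) ^^ Suc n"
    then obtain p q where *: "(\<phi> a, \<phi> p) \<in> (map_prod \<phi> \<phi> ` A) ^^ n" "(p, q) \<in> A" "\<phi> b = \<phi> q" by auto
    then have "p \<in> V" "q \<in> V" using sub by auto
    then have "q = b" using * inj Suc.prems by (metis inj_onD)
    then show "(a, b) \<in> A ^^ Suc n" using Suc.IH[OF \<open>p \<in> V\<close>] * by auto
  next
    assume "(a, b) \<in> A ^^ Suc n"
    then obtain p where *: "(a, p) \<in> A ^^ n" "(p, b) \<in> A" by auto
    then have "p \<in> V" using sub by auto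
    then have "(\<phi> a, \<phi> p) \<in> (map_prod \<phi> \<phi> ` A) ^^ n" using Suc.IH * by blast
    moreover have "(\<phi> p, \<phi> b) \<in> map_prod \<phi> \<phi> ` A" using * by (auto intro: image_eqI[of _ _ "(p, b)"])
    ultimately show "(\<phi> a, \<phi> b) \<in> (map_prod \<phi> \<phi> ` A) ^^ Suc n" by (rule relpow_Suc_I)
  qed
qed

lemma realizes_gdist:
  assumes T: "tree I L" and r: "realizes m \<phi> F I L" and "a \<in> tree_nodes I" "b \<in> tree_nodes I"
  shows "gdist m (\<phi> a) (\<phi> b) = tree_dist I a b"
  using relpow_map_prod_inj[OF _ tree_adj_subset[OF T] assms(3,4), of \<phi>] r
  unfolding gdist_def tree_dist_def realizes_def by simp

lemma realizes_internal_verts: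
  assumes "realizes m \<phi> F I L"
  shows "internal_verts m = (\<phi> \<circ> Inner) ` I"
proof -
  have v: "verts m = \<phi> ` tree_nodes I" and inj: "inj_on \<phi> (tree_nodes I)"
    and o: "\<exists>f \<in> faces m. \<not> bounded f" "\<And>f. f \<in> faces m \<Longrightarrow> \<not> bounded f \<Longrightarrow> face_verts m f = \<phi> ` range Outer"
    using assms unfolding realizes_def by auto
  have "internal_verts m = \<phi> ` tree_nodes I - \<phi> ` range Outer"
    using o unfolding internal_verts_def v by blast
  also have "\<dots> = \<phi> ` (tree_nodes I - range Outer)"
    using inj by (intro inj_on_image_set_diff[symmetric]) (auto simp: tree_nodes_def)
  also have "tree_nodes I - range Outer = Inner ` I" by (auto simp: tree_nodes_def)
  finally show ?thesis by (simp add: image_comp)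
qed

lemma realizes_triangle: "\<exists>\<phi> F. realizes triangle \<phi> F {} {[]}"
proof -
  define C where "C = closed_segment 1 \<i> \<union> closed_segment \<i> 0 \<union> closed_segment 0 1"
  note t = triangle_tri_face[folded C_def]
  define \<phi> where "\<phi> x = (case x of Outer i \<Rightarrow> (case i of C0 \<Rightarrow> 0 | C1 \<Rightarrow> 1 | C2 \<Rightarrow> \<i>) | Inner w \<Rightarrow> 0)" for x
  have nodes: "tree_nodes {} = {Outer C0, Outer C1, Outer C2}" "range Outer = {Outer C0, Outer C1, Outer C2}"
    by (auto simp: tree_nodes_def UNIV_corner)
  have bd: "bounded (inside C)" using tri_face_corners(9)[OF t(1)] .
  have "finite_faces triangle = {inside C}" unfolding finite_faces_def t(2) using bd t(4) by auto
  moreover have "adj triangle = map_prod \<phi> \<phi> ` tree_adj {}"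
  proof -
    have "tree_adj {} = range Outer \<times> range Outer - Id"
      unfolding tree_adj_def by auto
    also have "\<dots> = {(Outer C0, Outer C1), (Outer C0, Outer C2), (Outer C1, Outer C0), (Outer C1, Outer C2),
       (Outer C2, Outer C0), (Outer C2, Outer C1)}" unfolding nodes(2) by auto
    finally have "map_prod \<phi> \<phi> ` tree_adj {} = {(0, 1), (0, \<i>), (1, 0), (1, \<i>), (\<i>, 0), (\<i>, 1)}"
      by (simp add: \<phi>_def)
    also have "\<dots> = {0, 1, \<i>} \<times> {0, 1, \<i>} - Id" by auto
    finally show ?thesis unfolding adj_triangle by simp
  qed
  moreover have "face_verts triangle (outside C) = verts triangle"
    unfolding face_verts_def t(5) using t(6) by auto
  moreover have "verts triangle = \<phi> ` {Outer C0, Outer C1, Outer C2}"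
    by (simp add: triangle_def \<phi>_def)
  moreover have "inj_on \<phi> {Outer C0, Outer C1, Outer C2}" by (auto simp: inj_on_def \<phi>_def)
  ultimately have "realizes triangle \<phi> (\<lambda>_. inside C) {} {[]}"
    using t(1-4) bd unfolding realizes_def nodes by (auto simp: \<phi>_def bij_betw_def)
  then show ?thesis by blast
qed

lemma face_verts_image_emap:
  assumes "homeomorphism UNIV UNIV h (g :: complex \<Rightarrow> complex)"
  shows "face_verts (image_emap h m) (h ` f) = h ` face_verts m f"
  by (simp add: face_verts_def homeo_frontier[OF assms] image_Int[OF homeo_inj[OF assms]])

lemma realizes_image_emap:
  assumes hom: "homeomorphism UNIV UNIV h g" and r: "realizes m \<phi> F I L"
  shows "realizes (image_emap h m) (h \<circ> \<phi>) (\<lambda>u. h ` F u) I L"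
proof -
  have c: "closed (support m)" and b: "bij_betw F L (finite_faces m)" using r unfolding realizes_def by auto
  have "inj_on ((`) h) A" for A using homeo_inj[OF hom] by (auto simp: inj_on_def inj_image_eq_iff)
  then have "bij_betw ((`) h) (finite_faces m) (finite_faces (image_emap h m))"
    unfolding finite_faces_image_emap[OF hom c] by (simp add: bij_betw_def)
  from bij_betw_trans[OF b this] have "bij_betw (\<lambda>u. h ` F u) L (finite_faces (image_emap h m))"
    by (simp add: comp_def)
  moreover have "closed (support (image_emap h m))"
    using homeo_closed[OF hom c] by (simp add: support_image_emap)
  moreover have "inj_on (h \<circ> \<phi>) (tree_nodes I)"
    using r homeo_inj[OF hom] unfolding realizes_def by (auto intro: comp_inj_on inj_on_subset)
  moreover have "adj (image_emap h m) = map_prod (h \<circ> \<phi>) (h \<circ> \<phi>) ` tree_adj I"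
    using r unfolding adj_image_emap[OF hom] realizes_def by (simp add: image_comp map_prod_compose)
  moreover have "faces (image_emap h m) = (`) h ` faces m" by (rule faces_image_emap[OF hom c])
  ultimately show ?thesis
    using r unfolding realizes_def
    by (auto simp: image_comp homeo_bounded[OF hom] face_verts_image_emap[OF hom] intro!: tri_face_image_emap[OF hom])
qed

text \<open>
  The word \<open>s\<close> becomes an internal node whose image is the new vertex, and its three children address
  the three new faces of \<open>insertion_faces\<close>.
\<close>

lemma realizes_insertion:
  assumes T: "tree I L" and r: "realizes m \<phi> F I L" and s: "s \<in> L" and ins: "insertion m (F s) m'"
  shows "\<exists>\<phi>' F'. realizes m' \<phi>' F' (insert s I) (grow L s)"
proof -
  have cl: "closed (support m)" and inj: "inj_on \<phi> (tree_nodes I)" and ver: "verts m = \<phi> ` tree_nodes I"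
    and ad: "adj m = map_prod \<phi> \<phi> ` tree_adj I" and bij: "bij_betw F L (finite_faces m)"
    and tri: "\<And>u. u \<in> L \<Longrightarrow> tri_face m (F u) (\<phi> (corner_node u C0)) (\<phi> (corner_node u C1)) (\<phi> (corner_node u C2))"
    and unb: "\<exists>f \<in> faces m. \<not> bounded f" "\<And>f. f \<in> faces m \<Longrightarrow> \<not> bounded f \<Longrightarrow> face_verts m f = \<phi> ` range Outer"
    using r unfolding realizes_def by auto
  define a where "a = \<phi> (corner_node s C0)"
  define b where "b = \<phi> (corner_node s C1)"
  define c where "c = \<phi> (corner_node s C2)"
  have Fs: "F s \<in> faces m" "bounded (F s)" using bij s unfolding bij_betw_def finite_faces_def by auto
  obtain x fa fb fc where x: "x \<in> F s" "verts m' = insert x (verts m)"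
    and fm': "faces m' = faces m - {F s} \<union> {fa, fb, fc}" and dist: "fa \<noteq> fb" "fb \<noteq> fc" "fc \<noteq> fa"
    and new: "{fa, fb, fc} \<inter> faces m \<subseteq> {F s}"
    and t: "tri_face m' fa x b c" "tri_face m' fb a x c" "tri_face m' fc a b x"
    and old: "\<And>g p q r. tri_face m g p q r \<Longrightarrow> tri_face m' g p q r"
    and ad': "adj m' = adj m \<union> {x} \<times> {a, b, c} \<union> {a, b, c} \<times> {x}" and cl': "closed (support m')"
    by (rule insertion_faces[OF cl Fs(1) tri[OF s, folded a_def b_def c_def] ins]) blast
  have sI: "s \<notin> I" using tree_leaf_not_prefix_of_internal[OF T s, of s] by auto
  define \<phi>' where "\<phi>' = \<phi>(Inner s := x)"
  define F' where "F' u = (if u = s @ [C0] then fa else if u = s @ [C1] then fb else if u = s @ [C2] then fc else F u)" for u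
  have nodes: "tree_nodes (insert s I) = insert (Inner s) (tree_nodes I)" "Inner s \<notin> tree_nodes I"
    using sI by (auto simp: tree_nodes_def)
  have \<phi>': "\<phi>' y = \<phi> y" if "y \<in> tree_nodes I" for y using that nodes unfolding \<phi>'_def by auto
  have \<phi>s: "\<phi>' (Inner s) = x" by (simp add: \<phi>'_def)
  have cn: "corner_node u i \<in> tree_nodes I" if "u \<in> L" for u i using tree_corner_in_nodes[OF T] that by blast
  have xv: "x \<notin> verts m"
    using Fs(1) in_components_subset x(1) unfolding faces_def support_def by blast
  have "inj_on \<phi>' (tree_nodes (insert s I))"
  proof -
    have "inj_on \<phi>' (tree_nodes I)" using inj \<phi>' by (simp cong: inj_on_cong)
    moreover have "\<phi>' (Inner s) \<notin> \<phi>' ` tree_nodes I"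
      using xv \<phi>' unfolding ver by (auto simp: \<phi>s image_iff)
    ultimately show ?thesis using nodes(2) unfolding nodes(1) by simp
  qed
  moreover have "verts m' = \<phi>' ` tree_nodes (insert s I)"
  proof -
    have "\<phi>' ` tree_nodes I = \<phi> ` tree_nodes I" using \<phi>' by (rule image_cong[OF refl])
    then show ?thesis unfolding nodes x(2) ver by (simp add: \<phi>s)
  qed
  moreover have "adj m' = map_prod \<phi>' \<phi>' ` tree_adj (insert s I)"
  proof -
    have ta: "tree_adj (insert s I) = tree_adj I \<union> {Inner s} \<times> range (corner_node s) \<union> range (corner_node s) \<times> {Inner s}"
      unfolding tree_adj_def by auto
    have "map_prod \<phi>' \<phi>' ` tree_adj I = map_prod \<phi> \<phi> ` tree_adj I"
      using tree_adj_subset[OF T] \<phi>' by (intro image_cong[OF refl]) auto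
    moreover have "\<phi>' ` range (corner_node s) = {a, b, c}"
      using \<phi>'[OF cn[OF s]] unfolding UNIV_corner a_def b_def c_def by simp
    moreover have "map_prod \<phi>' \<phi>' ` (X \<times> Y) = (\<phi>' ` X) \<times> (\<phi>' ` Y)" for X Y by auto
    ultimately show ?thesis unfolding ta image_Un ad' ad by (simp add: \<phi>s)
  qed
  moreover have Fold: "F' u = F u" if "u \<in> L" for u
  proof -
    have "s @ [i] \<noteq> u" for i
      using tree_prefix_free[OF T that s] by (auto simp: parallel_def)
    then show ?thesis unfolding F'_def by auto
  qed
  have "bij_betw F' (grow L s) (finite_faces m')"
  proof -
    have bnd: "bounded fa" "bounded fb" "bounded fc" using tri_face_corners(9) t by blast+
    have "bij_betw F (L - {s}) (finite_faces m - {F s})"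
    proof -
      have "inj_on F L" "F ` L = finite_faces m" using bij unfolding bij_betw_def by auto
      moreover have "F ` (L - {s}) = F ` L - F ` {s}"
        using s \<open>inj_on F L\<close> by (intro inj_on_image_set_diff) auto
      ultimately show ?thesis unfolding bij_betw_def by (auto intro: inj_on_diff)
    qed
    then have "bij_betw F' (L - {s}) (finite_faces m - {F s})"
      using bij_betw_cong[of "L - {s}" F F'] Fold by auto
    moreover have "bij_betw F' (range (\<lambda>c. s @ [c])) {fa, fb, fc}"
      using dist unfolding UNIV_corner F'_def by (auto simp: bij_betw_def)
    moreover have "(finite_faces m - {F s}) \<inter> {fa, fb, fc} = {}"
      using new unfolding finite_faces_def by blast
    moreover have "finite_faces m' = (finite_faces m - {F s}) \<union> {fa, fb, fc}"
      unfolding finite_faces_def fm' using bnd by auto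
    ultimately show ?thesis unfolding grow_def by (metis bij_betw_combine)
  qed
  moreover have "tri_face m' (F' u) (\<phi>' (corner_node u C0)) (\<phi>' (corner_node u C1)) (\<phi>' (corner_node u C2))"
    if u: "u \<in> grow L s" for u
  proof (cases "u \<in> L")
    case True
    then show ?thesis using old[OF tri[OF True]] \<phi>' cn Fold by simp
  next
    case False
    then obtain i where i: "u = s @ [i]" using u unfolding grow_def by auto
    show ?thesis
      using t \<phi>'[OF cn[OF s]] unfolding i by (cases i) (auto simp: \<phi>s F'_def a_def b_def c_def)
  qed
  moreover have "face_verts m' f = \<phi>' ` range Outer" if f: "f \<in> faces m'" "\<not> bounded f" for f
  proof -
    have f': "f \<in> faces m" "f \<noteq> F s"
      using f Fs tri_face_corners(9) t unfolding fm' by blast+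
    have disj: "F s \<inter> f = {}"
      using f' Fs components_nonoverlap unfolding faces_def by blast
    have "open (F s)" using tri_face_corners(6) tri[OF s] by blast
    then have "F s \<inter> closure f = {}" using disj open_Int_closure_eq_empty by blast
    then have "x \<notin> frontier f" using x(1) unfolding frontier_def by blast
    then have "face_verts m' f = face_verts m f" unfolding face_verts_def x(2) by auto
    also have "\<dots> = \<phi> ` range Outer" using unb f' f by blast
    also have "\<dots> = \<phi>' ` range Outer" using \<phi>' by (intro image_cong[OF refl]) (auto simp: tree_nodes_def)
    finally show ?thesis .
  qed
  moreover have "\<exists>f \<in> faces m'. \<not> bounded f"
    using unb(1) Fs unfolding fm' by blast
  ultimately have "realizes m' \<phi>' F' (insert s I) (grow L s)" using cl' unfolding realizes_def by blast
  then show ?thesis by blast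
qed

section \<open>Coupling\<close>

text \<open>
  A map is represented through its chosen drawing. Straightness is carried along because it is needed
  for the next insertion to have a straight drawing.
\<close>

definition represents :: "rooted_map \<Rightarrow> corner list set \<Rightarrow> bool" where
  "represents M L \<longleftrightarrow> straight (drawing M) \<and> (\<exists>I \<phi> F. tree I L \<and> realizes (drawing M) \<phi> F I L)"

lemma drawing_in:
  assumes "m \<in> M" "straight m" shows "drawing M \<in> M \<and> straight (drawing M)"
  unfolding drawing_def by (rule someI[of _ m]) (use assms in blast)

lemma rooted_map_ofE:
  assumes "m' \<in> rooted_map_of m" obtains h g where "homeomorphism UNIV UNIV h g" "m' = image_emap h m"
  using assms unfolding rooted_map_of_def orientation_preserving_homeo_def by blast

lemma represents_Theta: "represents Theta {[]}"
proof -
  have d: "drawing Theta \<in> Theta" "straight (drawing Theta)"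
    using drawing_in[OF _ straight_triangle, of Theta] in_rooted_map_of unfolding Theta_def by blast+
  obtain h g where "homeomorphism UNIV UNIV h g" "drawing Theta = image_emap h triangle"
    using d(1) rooted_map_ofE unfolding Theta_def by blast
  moreover obtain \<phi> F where "realizes triangle \<phi> F {} {[]}" using realizes_triangle by blast
  ultimately have "realizes (drawing Theta) (h \<circ> \<phi>) (\<lambda>u. h ` F u) {} {[]}" using realizes_image_emap by simp
  then show ?thesis using d(2) tree_root unfolding represents_def by blast
qed

text \<open>
  The class of the new map contains a straight drawing, so the chosen one is a straight drawing in
  that class; it is a homeomorphic image of some insertion into the old drawing, not necessarily of
  the one with straight arcs.
\<close>

lemma represents_Phi:
  assumes T: "tree I L" and r: "realizes (drawing M) \<phi> F I L" and st: "straight (drawing M)" and s: "s \<in> L"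
  shows "represents (Phi (drawing M) (F s)) (grow L s)"
proof -
  let ?m = "drawing M" and ?P = "Phi (drawing M) (F s)"
  have tf: "tri_face ?m (F s) (\<phi> (corner_node s C0)) (\<phi> (corner_node s C1)) (\<phi> (corner_node s C2))"
    using r s unfolding realizes_def by blast
  obtain m' where m': "insertion ?m (F s) m'" "straight m'" using straight_insertion_exists[OF st tf] by blast
  then have "m' \<in> ?P" unfolding Phi_def using in_rooted_map_of by blast
  then have d: "drawing ?P \<in> ?P" "straight (drawing ?P)" using drawing_in m' by blast+
  obtain m'' where m'': "insertion ?m (F s) m''" "drawing ?P \<in> rooted_map_of m''"
    using d(1) unfolding Phi_def by blast
  obtain h g where "homeomorphism UNIV UNIV h g" "drawing ?P = image_emap h m''"
    using m''(2) rooted_map_ofE by blast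
  moreover obtain \<phi>' F' where "realizes m'' \<phi>' F' (insert s I) (grow L s)"
    using realizes_insertion[OF T r s m''(1)] by blast
  ultimately have "realizes (drawing ?P) (h \<circ> \<phi>') (\<lambda>u. h ` F' u) (insert s I) (grow L s)"
    using realizes_image_emap by simp
  then show ?thesis using d(2) tree_grow[OF T s] unfolding represents_def by blast
qed

text \<open>
  A coupling is the right notion because a map does not determine the set of leaves: permuting the
  letters of all words gives another tree realized by the same drawing. In each step the bijection
  between leaves and finite faces matches the two uniform choices.
\<close>

lemma stack_law_coupling: "rel_pmf represents (stack_law (Suc k)) (leaf_law k)"
proof (induction k)
  case 0
  then show ?case by (simp add: represents_Theta)
next
  case (Suc k)
  have "rel_pmf represents (map_pmf (Phi (drawing M)) (pmf_of_set (finite_faces (drawing M)))) (map_pmf (grow L) (pmf_of_set L))"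
    if rep: "represents M L" for M L
  proof -
    obtain I \<phi> F where T: "tree I L" and r: "realizes (drawing M) \<phi> F I L" and st: "straight (drawing M)"
      using rep unfolding represents_def by blast
    have L: "finite L" "L \<noteq> {}" using tree_finite[OF T] tree_card[OF T] by auto
    have "bij_betw F L (finite_faces (drawing M))" using r unfolding realizes_def by blast
    then have "pmf_of_set (finite_faces (drawing M)) = map_pmf F (pmf_of_set L)"
      using L by (simp add: map_pmf_of_set_bij_betw)
    moreover have "set_pmf (pmf_of_set L) = L" using L by simp
    ultimately show ?thesis
      using represents_Phi[OF T r st] by (auto simp: pmf.rel_map intro!: rel_pmf_reflI)
  qed
  then show ?case by (auto intro!: rel_pmf_bindI[OF Suc])
qed

section \<open>Two uniform nodes\<close>

lemma pair_pmf_of_set: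
  assumes "finite A" "A \<noteq> {}" "finite B" "B \<noteq> {}"
  shows "pair_pmf (pmf_of_set A) (pmf_of_set B) = pmf_of_set (A \<times> B)"
proof (rule pmf_eqI)
  fix p :: "'a \<times> 'b"
  show "pmf (pair_pmf (pmf_of_set A) (pmf_of_set B)) p = pmf (pmf_of_set (A \<times> B)) p"
    using assms by (cases p) (simp add: pmf_pair indicator_def card_cartesian_product)
qed

lemma Pi_pmf_two_components:
  assumes "finite A" "i \<in> A" "j \<in> A" "i \<noteq> j"
  shows "map_pmf (\<lambda>v. (v i, v j)) (Pi_pmf A d p) = pair_pmf (p i) (p j)"
proof -
  have "Pi_pmf A d p = Pi_pmf (insert i (A - {i})) d p" using assms by (simp add: insert_absorb)
  also have "\<dots> = map_pmf (\<lambda>(y, f). f(i := y)) (pair_pmf (p i) (Pi_pmf (A - {i}) d p))"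
    using assms by (intro Pi_pmf_insert) auto
  finally have "map_pmf (\<lambda>v. (v i, v j)) (Pi_pmf A d p) =
      map_pmf (apsnd (\<lambda>f. f j)) (pair_pmf (p i) (Pi_pmf (A - {i}) d p))"
    using assms by (simp add: map_pmf_comp case_prod_beta' apsnd_def map_prod_def)
  also have "\<dots> = pair_pmf (p i) (map_pmf (\<lambda>f. f j) (Pi_pmf (A - {i}) d p))"
    by (rule pair_map_pmf2[symmetric])
  also have "map_pmf (\<lambda>f. f j) (Pi_pmf (A - {i}) d p) = p j"
    using assms by (simp add: Pi_pmf_component)
  finally show ?thesis .
qed

text \<open>
  Markov's inequality, with the mean over two independent uniform points written as a double sum.
\<close>

lemma prob_two_uniform_le:
  fixes g :: "'a \<Rightarrow> 'a \<Rightarrow> real"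
  assumes N: "finite N" "N \<noteq> {}" and A: "finite A" "i \<in> A" "j \<in> A" "i \<noteq> j"
    and g: "\<And>a b. a \<in> N \<Longrightarrow> b \<in> N \<Longrightarrow> of_bool (P a b) \<le> g a b"
  shows "measure_pmf.prob (Pi_pmf A d (\<lambda>_. pmf_of_set N)) {v. P (v i) (v j)} \<le> (\<Sum>a\<in>N. \<Sum>b\<in>N. g a b) / (real (card N))\<^sup>2"
proof -
  have "measure_pmf.prob (Pi_pmf A d (\<lambda>_. pmf_of_set N)) {v. P (v i) (v j)} =
      measure_pmf.prob (map_pmf (\<lambda>v. (v i, v j)) (Pi_pmf A d (\<lambda>_. pmf_of_set N))) {(a, b). P a b}"
    by (simp add: vimage_def)
  also have "\<dots> = real (card (N \<times> N \<inter> {(a, b). P a b})) / (real (card N))\<^sup>2"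
    using N unfolding Pi_pmf_two_components[OF A] pair_pmf_of_set[OF N N]
    by (subst measure_pmf_of_set) (auto simp: card_cartesian_product power2_eq_square)
  also have "real (card (N \<times> N \<inter> {(a, b). P a b})) = (\<Sum>p\<in>N \<times> N. of_bool (case p of (a, b) \<Rightarrow> P a b))"
    using N by (simp add: sum_of_bool_eq)
  also have "\<dots> = (\<Sum>a\<in>N. \<Sum>b\<in>N. of_bool (P a b))"
    unfolding sum.cartesian_product by (rule sum.cong) auto
  also have "\<dots> \<le> (\<Sum>a\<in>N. \<Sum>b\<in>N. g a b)" by (intro sum_mono g)
  finally show ?thesis by (simp add: divide_right_mono)
qed

lemma rel_pmf_nn_integral_le:
  assumes "rel_pmf R p q" "\<And>x y. R x y \<Longrightarrow> y \<in> set_pmf q \<Longrightarrow> f x \<le> g y"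
  shows "(\<integral>\<^sup>+x. f x \<partial>measure_pmf p) \<le> (\<integral>\<^sup>+y. g y \<partial>measure_pmf q)"
proof -
  obtain pq where pq: "\<And>x y. (x, y) \<in> set_pmf pq \<Longrightarrow> R x y" "map_pmf fst pq = p" "map_pmf snd pq = q"
    using assms(1) by (auto elim: rel_pmf.cases)
  have "(\<integral>\<^sup>+x. f x \<partial>measure_pmf p) = (\<integral>\<^sup>+z. f (fst z) \<partial>measure_pmf pq)" unfolding pq(2)[symmetric] by simp
  also have "\<dots> \<le> (\<integral>\<^sup>+z. g (snd z) \<partial>measure_pmf pq)"
  proof (intro nn_integral_mono_AE AE_pmfI)
    fix z assume "z \<in> set_pmf pq"
    then show "f (fst z) \<le> g (snd z)"
      using pq(1)[of "fst z" "snd z"] assms(2) unfolding pq(3)[symmetric] by auto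
  qed
  also have "\<dots> = (\<integral>\<^sup>+y. g y \<partial>measure_pmf q)" unfolding pq(3)[symmetric] by simp
  finally show ?thesis .
qed

section \<open>Choice of the exponents\<close>

text \<open>
  The logarithm of \<open>zval t\<close> is \<open>0\<close> at \<open>t = 3\<close> and has derivative \<open>1/3 + 1/2 + 1 = 11/6\<close> there. The sign of
  the derivative below changes at \<open>x = 6/11\<close>, which is where the constant of the theorem comes from.
\<close>

lemma DERIV_log_zval:
  "((\<lambda>t. x * ln (zval t) - (t - 3)) has_real_derivative x * (11 / 6) - 1) (at 3)"
  unfolding zval_def by (auto intro!: derivative_eq_intros)

lemma exponent_above:
  assumes "x > 6 / 11" obtains t where "t > 3" "t - 3 < x * ln (zval t)"
proof -
  obtain d where "d > 0" "\<And>h. h > 0 \<Longrightarrow> h < d \<Longrightarrow> x * ln (zval 3) - (3 - 3) < x * ln (zval (3 + h)) - (3 + h - 3)"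
    using DERIV_pos_inc_right[OF DERIV_log_zval[of x]] assms by auto
  from this(2)[of "d / 2"] \<open>d > 0\<close> show thesis
    by (intro that[of "3 + d / 2"]) (auto simp: zval_def)
qed

lemma exponent_below:
  assumes "x < 6 / 11" obtains t where "2 < t" "t < 3" "t - 3 < x * ln (zval t)"
proof -
  obtain d where "d > 0" "\<And>h. h > 0 \<Longrightarrow> h < d \<Longrightarrow> x * ln (zval 3) - (3 - 3) < x * ln (zval (3 - h)) - (3 - h - 3)"
    using DERIV_neg_dec_left[OF DERIV_log_zval[of x]] assms by auto
  note d = this
  define h where "h = min (d / 2) (1 / 2)"
  have h: "h > 0" "h < d" "h < 1" using \<open>d > 0\<close> unfolding h_def by auto
  have "zval 3 = 1" by (simp add: zval_def)
  then show thesis using d(2)[OF h(1,2)] h by (intro that[of "3 - h"]) auto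
qed

lemma zval_gt_1: assumes "t > 3" shows "zval t > 1"
proof -
  have "t * (t - 1) > 3 * 2" using assms by (intro mult_strict_mono) auto
  then have "t * (t - 1) * (t - 2) > (3 * 2) * 1" using assms by (intro mult_strict_mono) auto
  then show ?thesis by (simp add: zval_def)
qed

lemma zval_less_1: assumes "2 < t" "t < 3" shows "zval t < 1"
proof -
  have "t * (t - 1) < 3 * 2" using assms by (intro mult_strict_mono) auto
  then have "t * (t - 1) * (t - 2) < (3 * 2) * 1" using assms by (intro mult_strict_mono) auto
  then show ?thesis by (simp add: zval_def)
qed

text \<open>
  One estimate for both tails: \<open>zval t\<close> exceeds 1 exactly for \<open>t > 3\<close>.
\<close>

lemma chernoff:
  fixes y :: real and D :: nat
  assumes "t > 2" and side: "t > 3 \<and> y \<le> real D \<or> t < 3 \<and> real D \<le> y"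
  shows "1 \<le> exp (- (y * ln (zval t))) * zval t ^ D"
proof -
  have z: "zval t > 0" using zval_pos assms(1) by blast
  have "y * ln (zval t) \<le> real D * ln (zval t)"
    using side
  proof (elim disjE conjE)
    assume "t > 3" "y \<le> real D"
    then show ?thesis using zval_gt_1[of t] by (intro mult_right_mono) auto
  next
    assume "t < 3" "real D \<le> y"
    then show ?thesis using zval_less_1[of t] assms(1) z by (intro mult_right_mono_neg) auto
  qed
  then have "1 \<le> exp (- (y * ln (zval t)) + real D * ln (zval t))" by simp
  also have "\<dots> = exp (- (y * ln (zval t))) * zval t ^ D"
    using z by (simp only: exp_add exp_of_nat_mult exp_ln)
  finally show ?thesis .
qed

lemma moment_const_nonneg: "t > 2 \<Longrightarrow> moment_const t \<ge> 0"
  by (simp add: moment_const_def add_nonneg_nonneg)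

definition deviation :: "nat \<Rightarrow> real \<Rightarrow> nat \<Rightarrow> (emap \<times> (nat \<Rightarrow> complex)) set" where
  "deviation n \<epsilon> k = {(m, v). \<exists>i \<in> {1..k}. \<exists>j \<in> {1..k}.
     \<bar>real (gdist m (v i) (v j)) / (3 * Gamma_tri * ln (real n)) - (if i \<noteq> j then 1 else 0)\<bar> > \<epsilon>}"

text \<open>
  The factor of the potential in the bound for one of the two tails: a union bound over at most \<open>k\<^sup>2\<close>
  pairs, the uniform choice among \<open>n - 1\<close> nodes, and the exponential factor of \<open>chernoff\<close> at the level
  \<open>x * ln n\<close>.
\<close>

definition tail_bound :: "nat \<Rightarrow> nat \<Rightarrow> real \<Rightarrow> real \<Rightarrow> real" where
  "tail_bound k n x t = (real k)\<^sup>2 / (real (n - 1))\<^sup>2 * exp (- (x * ln (real n) * ln (zval t))) * moment_const t"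

lemma gdist_self: "gdist m a a = 0"
  unfolding gdist_def by (intro Least_equality) auto

text \<open>
  Given the map, a deviation forces an upper or a lower one for two distinct indices; a diagonal entry
  is exactly 0. Two nodes that coincide are at distance 0, and if that is a deviation then it lies in
  the lower tail, so collisions need no separate estimate.
\<close>

lemma conditional_deviation_le:
  assumes n: "n \<ge> 2" and "\<epsilon> > 0" and t1: "t1 > 3" and t2: "2 < t2" "t2 < 3"
    and rep: "represents M L" and card: "card L = 2 * (n - 1) + 1"
  shows "measure_pmf.prob (map_pmf (Pair (drawing M))
      (Pi_pmf {1..k} undefined (\<lambda>_. pmf_of_set (internal_verts (drawing M))))) (deviation n \<epsilon> k)
    \<le> tail_bound k n (6 / 11 * (1 + \<epsilon>)) t1 * potential t1 L + tail_bound k n (6 / 11 * (1 - \<epsilon>)) t2 * potential t2 L"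
proof -
  define m where "m = drawing M"
  obtain I \<phi> F where T: "tree I L" and r: "realizes m \<phi> F I L"
    using rep unfolding represents_def m_def by blast
  define N where "N = internal_verts m"
  have N: "N = (\<phi> \<circ> Inner) ` I" using realizes_internal_verts[OF r] N_def by simp
  have inj: "inj_on (\<phi> \<circ> Inner) I"
  proof (rule comp_inj_on)
    show "inj_on Inner I" by (auto simp: inj_on_def)
    show "inj_on \<phi> (Inner ` I)" using r unfolding realizes_def tree_nodes_def by (auto intro: inj_on_subset)
  qed
  have cI: "card I = n - 1" using tree_card[OF T] card by simp
  have finN: "finite N" "N \<noteq> {}" and cN: "card N = n - 1"
    using tree_finite[OF T] cI n card_image[OF inj] unfolding N by auto
  define y1 where "y1 = 6 / 11 * (1 + \<epsilon>) * ln (real n)"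
  define y2 where "y2 = 6 / 11 * (1 - \<epsilon>) * ln (real n)"
  define e1 where "e1 = exp (- (y1 * ln (zval t1)))"
  define e2 where "e2 = exp (- (y2 * ln (zval t2)))"
  have ln0: "ln (real n) > 0" using n by simp
  define P where "P a b \<longleftrightarrow> \<bar>real (gdist m a b) / (3 * Gamma_tri * ln (real n)) - 1\<bar> > \<epsilon>" for a b
  define g where "g a b = e1 * zval t1 ^ gdist m a b + e2 * zval t2 ^ gdist m a b" for a b
  have g: "of_bool (P a b) \<le> g a b" for a b
  proof (cases "P a b")
    case True
    let ?D = "real (gdist m a b)"
    have "?D / (6 / 11 * ln (real n)) - 1 > \<epsilon> \<or> ?D / (6 / 11 * ln (real n)) - 1 < - \<epsilon>"
      using True unfolding P_def Gamma_tri_def by auto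
    then have "?D > y1 \<or> ?D < y2"
      using ln0 unfolding y1_def y2_def by (auto simp: field_simps)
    then have "1 \<le> e1 * zval t1 ^ gdist m a b \<or> 1 \<le> e2 * zval t2 ^ gdist m a b"
      using chernoff[of t1 y1 "gdist m a b"] chernoff[of t2 y2 "gdist m a b"] t1 t2 unfolding e1_def e2_def by auto
    moreover have "e1 * zval t1 ^ gdist m a b \<ge> 0" "e2 * zval t2 ^ gdist m a b \<ge> 0"
      using zval_pos[of t1] zval_pos[of t2] t1 t2 unfolding e1_def e2_def by auto
    ultimately show ?thesis unfolding g_def using True by auto
  next
    case False
    then show ?thesis using zval_pos[of t1] zval_pos[of t2] t1 t2 unfolding g_def e1_def e2_def
      by (auto intro!: add_nonneg_nonneg)
  qed
  have dist: "(\<Sum>a\<in>N. \<Sum>b\<in>N. z ^ gdist m a b) = (\<Sum>a\<in>I. \<Sum>b\<in>I. z ^ tree_dist I (Inner a) (Inner b))" for z :: real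
  proof -
    have "gdist m (\<phi> (Inner a)) (\<phi> (Inner b)) = tree_dist I (Inner a) (Inner b)" if "a \<in> I" "b \<in> I" for a b
      using realizes_gdist[OF T r] that by (auto simp: tree_nodes_def)
    then show ?thesis unfolding N sum.reindex[OF inj] by (intro sum.cong) auto
  qed
  let ?S = "e1 * (moment_const t1 * potential t1 L) + e2 * (moment_const t2 * potential t2 L)"
  have "(\<Sum>a\<in>N. \<Sum>b\<in>N. g a b) = e1 * (\<Sum>a\<in>N. \<Sum>b\<in>N. zval t1 ^ gdist m a b) + e2 * (\<Sum>a\<in>N. \<Sum>b\<in>N. zval t2 ^ gdist m a b)"
    unfolding g_def by (simp add: sum.distrib sum_distrib_left)
  also have "\<dots> \<le> ?S"
    unfolding dist using sum_power_tree_dist_le[OF T] t1 t2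
    by (intro add_mono mult_left_mono) (auto simp: e1_def e2_def)
  finally have sumg: "(\<Sum>a\<in>N. \<Sum>b\<in>N. g a b) \<le> ?S" .
  let ?Pi = "Pi_pmf {1..k} undefined (\<lambda>_. pmf_of_set N)"
  let ?Q = "{(i, j). i \<in> {1..k} \<and> j \<in> {1..k} \<and> i \<noteq> j}"
  have Qsub: "?Q \<subseteq> {1..k} \<times> {1..k}" by auto
  then have finQ: "finite ?Q" by (rule finite_subset) simp
  have cQ: "card ?Q \<le> k\<^sup>2" using card_mono[OF _ Qsub] by (simp add: card_cartesian_product power2_eq_square)
  have one: "measure_pmf.prob ?Pi {v. P (v i) (v j)} \<le> ?S / (real (n - 1))\<^sup>2" if "(i, j) \<in> ?Q" for i j
  proof -
    have "measure_pmf.prob ?Pi {v. P (v i) (v j)} \<le> (\<Sum>a\<in>N. \<Sum>b\<in>N. g a b) / (real (card N))\<^sup>2"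
      using that by (intro prob_two_uniform_le finN g) auto
    also have "\<dots> \<le> ?S / (real (n - 1))\<^sup>2" unfolding cN by (intro divide_right_mono sumg) auto
    finally show ?thesis .
  qed
  have "Pair m -` deviation n \<epsilon> k \<subseteq> (\<Union>q\<in>?Q. {v. P (v (fst q)) (v (snd q))})"
  proof
    fix v assume "v \<in> Pair m -` deviation n \<epsilon> k"
    then obtain i j where ij: "i \<in> {1..k}" "j \<in> {1..k}"
      "\<bar>real (gdist m (v i) (v j)) / (3 * Gamma_tri * ln (real n)) - (if i \<noteq> j then 1 else 0)\<bar> > \<epsilon>"
      unfolding deviation_def by auto
    then have "i \<noteq> j" using \<open>\<epsilon> > 0\<close> by (auto simp: gdist_self)
    then show "v \<in> (\<Union>q\<in>?Q. {v. P (v (fst q)) (v (snd q))})"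
      using ij unfolding P_def by auto
  qed
  then have "measure_pmf.prob ?Pi (Pair m -` deviation n \<epsilon> k) \<le> measure_pmf.prob ?Pi (\<Union>q\<in>?Q. {v. P (v (fst q)) (v (snd q))})"
    by (intro measure_pmf.finite_measure_mono) auto
  also have "\<dots> \<le> (\<Sum>q\<in>?Q. measure_pmf.prob ?Pi {v. P (v (fst q)) (v (snd q))})"
    by (intro measure_pmf.finite_measure_subadditive_finite finQ) auto
  also have "\<dots> \<le> (\<Sum>q\<in>?Q. ?S / (real (n - 1))\<^sup>2)"
    by (intro sum_mono) (use one in auto)
  also have "\<dots> = real (card ?Q) * (?S / (real (n - 1))\<^sup>2)" by simp
  also have "\<dots> \<le> (real k)\<^sup>2 * (?S / (real (n - 1))\<^sup>2)"
  proof (rule mult_right_mono)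
    show "real (card ?Q) \<le> (real k)\<^sup>2" using of_nat_mono[OF cQ, where 'a = real] by (simp only: of_nat_power)
    have "0 \<le> (\<Sum>a\<in>N. \<Sum>b\<in>N. g a b)"
      by (intro sum_nonneg order_trans[OF _ g]) simp
    then show "0 \<le> ?S / (real (n - 1))\<^sup>2" using sumg by (intro divide_nonneg_nonneg) auto
  qed
  also have "\<dots> = tail_bound k n (6 / 11 * (1 + \<epsilon>)) t1 * potential t1 L + tail_bound k n (6 / 11 * (1 - \<epsilon>)) t2 * potential t2 L"
  proof -
    have "A * ((b * (c * d) + b' * (c' * d')) / q) = A / q * b * c * d + A / q * b' * c' * d'"
      for A b c d b' c' d' q :: real by (simp add: add_divide_distrib distrib_left)
    then show ?thesis unfolding tail_bound_def e1_def e2_def y1_def y2_def .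
  qed
  finally show ?thesis unfolding m_def[symmetric] N_def[symmetric] by simp
qed

lemma potential_nonneg: "t > 2 \<Longrightarrow> potential t L \<ge> 0"
  unfolding potential_def pair_sum_def by (intro add_nonneg_nonneg sum_nonneg pair_weight_nonneg) auto

lemma tail_bound_nonneg: "t > 2 \<Longrightarrow> tail_bound k n x t \<ge> 0"
  unfolding tail_bound_def using moment_const_nonneg by (intro mult_nonneg_nonneg) auto

lemma deviation_prob_le:
  assumes n: "n \<ge> 2" and "\<epsilon> > 0" and t1: "t1 > 3" and t2: "2 < t2" "t2 < 3"
  shows "measure_pmf.prob (stack_nodes_law n k) (deviation n \<epsilon> k)
    \<le> tail_bound k n (6 / 11 * (1 + \<epsilon>)) t1 * measure_pmf.expectation (leaf_law (n - 1)) (potential t1)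
      + tail_bound k n (6 / 11 * (1 - \<epsilon>)) t2 * measure_pmf.expectation (leaf_law (n - 1)) (potential t2)"
proof -
  let ?a = "tail_bound k n (6 / 11 * (1 + \<epsilon>)) t1" and ?b = "tail_bound k n (6 / 11 * (1 - \<epsilon>)) t2"
  define G where "G L = ?a * potential t1 L + ?b * potential t2 L" for L
  have G0: "G L \<ge> 0" for L
    unfolding G_def using tail_bound_nonneg potential_nonneg t1 t2 by (intro add_nonneg_nonneg mult_nonneg_nonneg) auto
  have int: "integrable (measure_pmf (leaf_law (n - 1))) f" for f :: "_ \<Rightarrow> real"
    by (rule integrable_measure_pmf_finite[OF finite_leaf_law])
  have "emeasure (stack_nodes_law n k) (deviation n \<epsilon> k) =
    (\<integral>\<^sup>+M. emeasure (map_pmf (Pair (drawing M))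
      (Pi_pmf {1..k} undefined (\<lambda>_. pmf_of_set (internal_verts (drawing M))))) (deviation n \<epsilon> k) \<partial>stack_law n)"
    unfolding stack_nodes_law_def by (rule emeasure_bind_pmf)
  also have "\<dots> \<le> (\<integral>\<^sup>+L. ennreal (G L) \<partial>leaf_law (n - 1))"
  proof (rule rel_pmf_nn_integral_le)
    show "rel_pmf represents (stack_law n) (leaf_law (n - 1))"
      using stack_law_coupling[of "n - 1"] n by simp
    fix M L assume "represents M L" "L \<in> set_pmf (leaf_law (n - 1))"
    then show "emeasure (map_pmf (Pair (drawing M))
      (Pi_pmf {1..k} undefined (\<lambda>_. pmf_of_set (internal_verts (drawing M))))) (deviation n \<epsilon> k) \<le> ennreal (G L)"
      using conditional_deviation_le[OF n \<open>\<epsilon> > 0\<close> t1 t2, of M L] leaf_law_support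
      unfolding G_def measure_pmf.emeasure_eq_measure by (intro ennreal_leI) blast
  qed
  also have "\<dots> = ennreal (measure_pmf.expectation (leaf_law (n - 1)) G)"
    using G0 by (intro nn_integral_eq_integral int) auto
  finally have "measure_pmf.prob (stack_nodes_law n k) (deviation n \<epsilon> k) \<le> measure_pmf.expectation (leaf_law (n - 1)) G"
    using G0 by (simp add: measure_pmf.emeasure_eq_measure integral_nonneg)
  also have "\<dots> = ?a * measure_pmf.expectation (leaf_law (n - 1)) (potential t1) + ?b * measure_pmf.expectation (leaf_law (n - 1)) (potential t2)"
    unfolding G_def using int by simp
  finally show ?thesis .
qed

text \<open>
  The bound is of order \<open>n powr (t - 3 - x * ln (zval t))\<close>. The exponent is negative by the choice of \<open>t\<close>
  in \<open>exponent_above\<close> and \<open>exponent_below\<close>.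
\<close>

lemma tail_bound_tendsto_0:
  assumes t: "t > 2" and x: "t - 3 < x * ln (zval t)"
  shows "(\<lambda>n. tail_bound k n x t * measure_pmf.expectation (leaf_law (n - 1)) (potential t)) \<longlonglongrightarrow> 0"
proof -
  define y where "y = x * ln (zval t)"
  define K where "K = (real k)\<^sup>2 * moment_const t * (3 / (t - 2) * exp (3 * (t - 1)))"
  have K: "K \<ge> 0" unfolding K_def using moment_const_nonneg[OF t] t by auto
  have le: "tail_bound k n x t * measure_pmf.expectation (leaf_law (n - 1)) (potential t)
     \<le> K * 2 powr \<bar>t - 3\<bar> * real n powr (t - 3 - y)" if n: "n \<ge> 2" for n
  proof -
    define q where "q = real (n - 1)"
    have q: "q > 0" "q \<le> real n" "real n \<le> 2 * q" using n unfolding q_def by auto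
    have ex: "exp (- (x * ln (real n) * ln (zval t))) = real n powr (- y)"
      using n unfolding y_def by (simp add: powr_def mult.commute mult.left_commute)
    have "tail_bound k n x t * measure_pmf.expectation (leaf_law (n - 1)) (potential t)
      \<le> tail_bound k n x t * (3 / (t - 2) * exp (3 * (t - 1)) * q powr (t - 1))"
      unfolding q_def using n by (intro mult_left_mono expectation_potential_le t tail_bound_nonneg[OF t]) auto
    also have "\<dots> = K * real n powr (- y) * (q powr (t - 1) / q\<^sup>2)"
      unfolding tail_bound_def ex K_def q_def[symmetric] by (simp add: ac_simps)
    also have "q powr (t - 1) / q\<^sup>2 = q powr (t - 3)"
    proof -
      have "q\<^sup>2 = q powr 2" using q by simp
      then have "q powr (t - 1) / q\<^sup>2 = q powr (t - 1 - 2)" by (simp only: powr_diff)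
      then show ?thesis by simp
    qed
    also have "q powr (t - 3) \<le> 2 powr \<bar>t - 3\<bar> * real n powr (t - 3)"
    \<comment> \<open>For \<open>t < 3\<close> the power decreases, and \<open>n - 1\<close> is compared with \<open>n / 2\<close>.\<close>
    proof (cases "t \<ge> 3")
      case True
      then have "q powr (t - 3) \<le> real n powr (t - 3)" using q by (intro powr_mono2) auto
      also have "\<dots> \<le> 2 powr \<bar>t - 3\<bar> * real n powr (t - 3)"
        using ge_one_powr_ge_zero[of 2 "\<bar>t - 3\<bar>"] by (simp add: mult_le_cancel_right1)
      finally show ?thesis .
    next
      case False
      have "q powr (t - 3) \<le> (real n / 2) powr (t - 3)" using q n False by (intro powr_mono2') auto
      also have "\<dots> = 2 powr \<bar>t - 3\<bar> * real n powr (t - 3)"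
      proof -
        have "\<bar>t - 3\<bar> = - (t - 3)" using False by simp
        then have "2 powr \<bar>t - 3\<bar> = 1 / 2 powr (t - 3)" by (simp only: powr_minus_divide)
        then show ?thesis by (simp add: powr_divide)
      qed
      finally show ?thesis .
    qed
    finally have "tail_bound k n x t * measure_pmf.expectation (leaf_law (n - 1)) (potential t)
       \<le> K * real n powr (- y) * (2 powr \<bar>t - 3\<bar> * real n powr (t - 3))"
      using K by (simp add: mult_left_mono)
    also have "\<dots> = K * 2 powr \<bar>t - 3\<bar> * (real n powr (- y) * real n powr (t - 3))" by simp
    also have "real n powr (- y) * real n powr (t - 3) = real n powr (t - 3 - y)"
      by (simp flip: powr_add)
    finally show ?thesis .
  qed
  have "(\<lambda>n. real n powr (t - 3 - y)) \<longlonglongrightarrow> 0"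
    using x unfolding y_def by (intro tendsto_neg_powr filterlim_real_sequentially) auto
  then have lim: "(\<lambda>n. K * 2 powr \<bar>t - 3\<bar> * real n powr (t - 3 - y)) \<longlonglongrightarrow> 0"
    by (rule tendsto_mult_right_zero)
  have nn: "0 \<le> tail_bound k n x t * measure_pmf.expectation (leaf_law (n - 1)) (potential t)" for n
    using tail_bound_nonneg[OF t] potential_nonneg[OF t] by (intro mult_nonneg_nonneg integral_nonneg) auto
  show ?thesis
    by (rule tendsto_sandwich[OF _ _ tendsto_const lim])
      (use nn le in \<open>auto intro: eventually_sequentiallyI[of 2]\<close>)
qed

theorem theorem21:
  fixes k :: nat and \<epsilon> :: real
  assumes "\<epsilon> > 0"
  shows "(\<lambda>n. measure_pmf.prob (stack_nodes_law n k)
            {(m, v). \<exists>i \<in> {1..k}. \<exists>j \<in> {1..k}.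
               \<bar>real (gdist m (v i) (v j)) / (3 * Gamma_tri * ln (real n))
                  - (if i \<noteq> j then 1 else 0)\<bar> > \<epsilon>})
         \<longlonglongrightarrow> 0"
proof -
  obtain t1 where t1: "t1 > 3" "t1 - 3 < 6 / 11 * (1 + \<epsilon>) * ln (zval t1)"
    using exponent_above[of "6 / 11 * (1 + \<epsilon>)"] assms by auto
  obtain t2 where t2: "2 < t2" "t2 < 3" "t2 - 3 < 6 / 11 * (1 - \<epsilon>) * ln (zval t2)"
    using exponent_below[of "6 / 11 * (1 - \<epsilon>)"] assms by auto
  define B where "B n = tail_bound k n (6 / 11 * (1 + \<epsilon>)) t1 * measure_pmf.expectation (leaf_law (n - 1)) (potential t1)
      + tail_bound k n (6 / 11 * (1 - \<epsilon>)) t2 * measure_pmf.expectation (leaf_law (n - 1)) (potential t2)" for n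
  have "B \<longlonglongrightarrow> 0 + 0"
    unfolding B_def using t1 t2 by (intro tendsto_add tail_bound_tendsto_0) auto
  then have lim: "B \<longlonglongrightarrow> 0" by simp
  have "measure_pmf.prob (stack_nodes_law n k) (deviation n \<epsilon> k) \<le> B n" if "n \<ge> 2" for n
    unfolding B_def using deviation_prob_le[OF that assms t1(1) t2(1,2)] .
  then have upper: "\<forall>\<^sub>F n in sequentially. measure_pmf.prob (stack_nodes_law n k) (deviation n \<epsilon> k) \<le> B n"
    by (rule eventually_sequentiallyI)
  have lower: "\<forall>\<^sub>F n in sequentially. 0 \<le> measure_pmf.prob (stack_nodes_law n k) (deviation n \<epsilon> k)"
    by (rule always_eventually) simp
  have "(\<lambda>n. measure_pmf.prob (stack_nodes_law n k) (deviation n \<epsilon> k)) \<longlonglongrightarrow> 0"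
    by (rule tendsto_sandwich[OF lower upper tendsto_const lim])
  then show ?thesis unfolding deviation_def .
qed

end
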